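(* Let $\mathbf n=(n_1,\dots,n_k)\in\mathbb N^k$, let $$\varphi=\sum_{(p_1,\dots,p_k)\in\mathbb Z_+^k}\ \sum_{\substack{\alpha_i\in\mathbb F_{n_i}^+,\ |\alpha_i|=p_i\\ i\in\{1,\dots,k\}}}A_{(\alpha)}\otimes Z_{(\alpha)}$$ be a formal power series with coefficients $A_{(\alpha)}\in B(\mathcal K)$, and let $\mathbf r=(r_1,\dots,r_k)$ with $r_i>0$. Let $$A:=\Big\{\Big\|r_1^{2p_1}\cdots r_k^{2p_k}\sum_{\substack{\alpha_i\in\mathbb F_{n_i}^+,\ |\alpha_i|=p_i\\ i\in\{1,\dots,k\}}}A_{(\alpha)}^*A_{(\alpha)}\Big\|:\ (p_1,\dots,p_k)\in\mathbb Z_+^k\Big\}.$$ (i) If the set $A$ is bounded, then for every Hilbert space $\mathcal H$ the series $$\sum_{(p_1,\dots,p_k)\in\mathbb Z_+^k}\Big\|\sum_{\substack{\alpha_i\in\mathbb F_{n_i}^+,\ |\alpha_i|=p_i\\ i\in\{1,\dots,k\}}}A_{(\alpha)}\otimes X_{(\alpha)}\Big\|$$ is convergent for $\mathbf X\in\mathbf r\mathbf B_{\mathbf n}(\mathcal H)$, the regular polyball of polyradius $\mathbf r$, and uniformly convergent on $\mathbf s\mathbf B_{\mathbf n}(\mathcal H)^-$ for any $\mathbf s=(s_1,\dots,s_k)$ with $0\le s_i<r_i$. (ii) If the set $A$ is unbounded, then the series $$\sum_{(p_1,\dots,p_k)\in\mathbb Z_+^k}\Big\|\sum_{\substack{\alpha_i\in\mathbb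 F_{n_i}^+,\ |\alpha_i|=p_i\\ i\in\{1,\dots,k\}}}A_{(\alpha)}\otimes X_{(\alpha)}\Big\|\quad\text{and}\quad\sum_{(p_1,\dots,p_k)\in\mathbb Z_+^k}\ \sum_{\substack{\alpha_i\in\mathbb F_{n_i}^+,\ |\alpha_i|=p_i\\ i\in\{1,\dots,k\}}}A_{(\alpha)}\otimes X_{(\alpha)}$$ are divergent for some $\mathbf X\in\mathbf r\mathbf B_{\mathbf n}(\mathcal H)^-$ and some Hilbert space $\mathcal H$.
   Context: **Polyball.** For a complex Hilbert space $\mathcal H$, $B(\mathcal H)^{n_1}\times_c\cdots\times_c B(\mathcal H)^{n_k}$ is the set of tuples $\mathbf X=(X_1,\dots,X_k)$, $X_i=(X_{i,1},\dots,X_{i,n_i})\in B(\mathcal H)^{n_i}$, such that each entry of $X_s$ commutes with each entry of $X_t$ whenever $s\neq t$ (entries of a single $X_s$ need not commute). Put $\Phi_{X_i}(Y)=\sum_{j=1}^{n_i}X_{i,j}YX_{i,j}^*$ and $\mathbf\Delta_{\mathbf X}=(id-\Phi_{X_1})\circ\cdots\circ(id-\Phi_{X_k})$ on $B(\mathcal H)$. The regular polyball $\mathbf B_{\mathbf n}(\mathcal H)$ is the set of all such $\mathbf X$ with $\|\sum_jX_{i,j}X_{i,j}^*\|<1$ for each $i$ and $\mathbf\Delta_{\mathbf X}(I)>0$ (positive and invertible); $\mathbf B_{\mathbf n}(\mathcal H)^-$ is its operator-norm closure. For $\mathbf r=(r_1,\dots,r_k)$, $\mathbf r\mathbf X=(r_1X_1,\dots,r_kX_k)$,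 $\mathbf r\mathbf B_{\mathbf n}(\mathcal H)=\{\mathbf r\mathbf X:\mathbf X\in\mathbf B_{\mathbf n}(\mathcal H)\}$, and similarly for $\mathbf B_{\mathbf n}(\mathcal H)^-$. **Power series.** $\mathbb F_{n_i}^+$ is the unital free semigroup on generators $g^i_1,\dots,g^i_{n_i}$, with word length $|\cdot|$. $Z_{i,j}$ are indeterminates, where those with first index $p$ commute with those with first index $q\ne p$ (no relation for equal first index). For $\alpha=g^i_{j_1}\cdots g^i_{j_p}$ put $X_{i,\alpha}=X_{i,j_1}\cdots X_{i,j_p}$ ($I$ for the empty word), and for $(\alpha)=(\alpha_1,\dots,\alpha_k)$ put $X_{(\alpha)}=X_{1,\alpha_1}\cdots X_{k,\alpha_k}$; similarly $Z_{(\alpha)}$. $\mathcal K$ is a Hilbert space; $\mathbb Z_+$ denotes the nonnegative integers. Convergence of operator series is in the operator norm. *)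

theory Defs
  imports "HOL-Analysis.Analysis"
begin

section \<open>Complex Hilbert spaces\<close>

text \<open>
  A complex inner product space is a real inner product space (with the library's norm and
  topology) carrying a compatible complex scalar multiplication and a sesquilinear form, linear in
  the first argument, whose real part is the real inner product.
\<close>

class complex_inner = real_inner +
  fixes scaleC :: "complex \<Rightarrow> 'a \<Rightarrow> 'a"  (infixr \<open>*\<^sub>C\<close> 75)
    and cinner :: "'a \<Rightarrow> 'a \<Rightarrow> complex"
  assumes scaleC_add_right: "c *\<^sub>C (x + y) = c *\<^sub>C x + c *\<^sub>C y"
    and scaleC_add_left: "(c + d) *\<^sub>C x = c *\<^sub>C x + d *\<^sub>C x"
    and scaleC_scaleC: "c *\<^sub>C (d *\<^sub>C x) = (c * d) *\<^sub>C x"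
    and scaleC_of_real: "complex_of_real a *\<^sub>C x = a *\<^sub>R x"
    and cinner_commute: "cinner x y = cnj (cinner y x)"
    and cinner_add_left: "cinner (x + y) z = cinner x z + cinner y z"
    and cinner_scaleC_left: "cinner (c *\<^sub>C x) y = c * cinner x y"
    and Re_cinner: "Re (cinner x y) = inner x y"

class chilbert_space = complex_inner + complete_space

lemma cinner_add_right: "cinner x (y + z) = cinner x y + cinner x z"
  by (metis cinner_add_left cinner_commute complex_cnj_add)

lemma cinner_scaleC_right: "cinner x (c *\<^sub>C y) = cnj c * cinner x y"
  by (metis cinner_commute cinner_scaleC_left complex_cnj_mult)

lemma cinner_self: "cinner x x = complex_of_real ((norm x)\<^sup>2)"
proof -
  have "cinner x x = cnj (cinner x x)" by (rule cinner_commute)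
  then have "Im (cinner x x) = 0" by (metis Reals_cnj_iff complex_is_Real_iff)
  then show ?thesis by (simp add: complex_eq_iff Re_cinner power2_norm_eq_inner)
qed

lemma norm_scaleC: "norm (c *\<^sub>C x) = cmod c * norm x"
proof -
  have "cinner (c *\<^sub>C x) (c *\<^sub>C x) = (c * cnj c) * cinner x x"
    by (simp add: cinner_scaleC_left cinner_scaleC_right)
  then have "complex_of_real ((norm (c *\<^sub>C x))\<^sup>2) = complex_of_real ((cmod c * norm x)\<^sup>2)"
    by (simp only: cinner_self complex_norm_square[symmetric] of_real_mult[symmetric] power_mult_distrib)
  then show ?thesis by (simp only: of_real_eq_iff power2_eq_iff_nonneg norm_ge_zero mult_nonneg_nonneg)
qed

lemma inner_eq_Re_scaleC: "Im (cinner x y) = inner x (\<i> *\<^sub>C y)"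
proof -
  have "inner x (\<i> *\<^sub>C y) = Re (cinner x (\<i> *\<^sub>C y))" by (simp add: Re_cinner)
  then show ?thesis by (simp add: cinner_scaleC_right)
qed

lemma norm_cinner_le: "cmod (cinner x y) \<le> 2 * (norm x * norm y)"
proof -
  have "\<bar>Re (cinner x y)\<bar> \<le> norm x * norm y"
    by (simp add: Re_cinner Cauchy_Schwarz_ineq2)
  moreover have "\<bar>Im (cinner x y)\<bar> \<le> norm x * norm y"
    using Cauchy_Schwarz_ineq2[of x "\<i> *\<^sub>C y"] by (simp add: inner_eq_Re_scaleC norm_scaleC)
  ultimately show ?thesis using cmod_le[of "cinner x y"] by linarith
qed

instantiation complex :: chilbert_space
begin

definition scaleC_complex :: "complex \<Rightarrow> complex \<Rightarrow> complex" where
  "scaleC_complex c x = c * x"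

definition cinner_complex :: "complex \<Rightarrow> complex \<Rightarrow> complex" where
  "cinner_complex x y = x * cnj y"

instance
  by standard (auto simp: scaleC_complex_def cinner_complex_def algebra_simps scaleR_conv_of_real
      inner_complex_def)

end


section \<open>The Hilbert space of square summable sequences\<close>

typedef (overloaded) ('a::complex_inner) ell2 =
    "{f :: nat \<Rightarrow> 'a. summable (\<lambda>i. (norm (f i))\<^sup>2)}"
  morphisms ell2_nth Abs_ell2
  by (rule exI[of _ "\<lambda>_. 0"]) simp

setup_lifting type_definition_ell2

lemma summable_norm_sq_add:
  fixes f g :: "nat \<Rightarrow> 'a::real_normed_vector"
  assumes "summable (\<lambda>i. (norm (f i))\<^sup>2)" "summable (\<lambda>i. (norm (g i))\<^sup>2)"
  shows "summable (\<lambda>i. (norm (f i + g i))\<^sup>2)"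
proof (rule summable_comparison_test')
  show "summable (\<lambda>i. 2 * (norm (f i))\<^sup>2 + 2 * (norm (g i))\<^sup>2)"
    by (intro summable_add summable_mult assms)
  show "norm ((norm (f i + g i))\<^sup>2) \<le> 2 * (norm (f i))\<^sup>2 + 2 * (norm (g i))\<^sup>2" for i
  proof -
    have "(norm (f i + g i))\<^sup>2 \<le> (norm (f i) + norm (g i))\<^sup>2"
      by (intro power_mono norm_triangle_ineq) auto
    also have "\<dots> \<le> 2 * (norm (f i))\<^sup>2 + 2 * (norm (g i))\<^sup>2"
      using sum_squares_bound[of "norm (f i)" "norm (g i)"] by (simp add: power2_sum)
    finally show ?thesis by simp
  qed
qed

lemma summable_norm_mult:
  fixes f g :: "nat \<Rightarrow> 'a::real_normed_vector"
  assumes "summable (\<lambda>i. (norm (f i))\<^sup>2)" "summable (\<lambda>i. (norm (g i))\<^sup>2)"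
  shows "summable (\<lambda>i. norm (f i) * norm (g i))"
proof (rule summable_comparison_test')
  show "summable (\<lambda>i. (norm (f i))\<^sup>2 + (norm (g i))\<^sup>2)"
    by (intro summable_add assms)
  show "norm (norm (f i) * norm (g i)) \<le> (norm (f i))\<^sup>2 + (norm (g i))\<^sup>2" for i
    using sum_squares_bound[of "norm (f i)" "norm (g i)"]
      mult_nonneg_nonneg[OF norm_ge_zero norm_ge_zero, of "f i" "g i"]
    by (simp only: real_norm_def abs_of_nonneg)
qed

lemma summable_cinner:
  fixes f g :: "nat \<Rightarrow> 'a::complex_inner"
  assumes "summable (\<lambda>i. (norm (f i))\<^sup>2)" "summable (\<lambda>i. (norm (g i))\<^sup>2)"
  shows "summable (\<lambda>i. cinner (f i) (g i))"
  by (rule summable_comparison_test'[OF summable_mult[OF summable_norm_mult[OF assms], of 2]])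
     (rule norm_cinner_le)

lemma summable_inner:
  fixes f g :: "nat \<Rightarrow> 'a::real_inner"
  assumes "summable (\<lambda>i. (norm (f i))\<^sup>2)" "summable (\<lambda>i. (norm (g i))\<^sup>2)"
  shows "summable (\<lambda>i. inner (f i) (g i))"
  by (rule summable_comparison_test'[OF summable_norm_mult[OF assms]])
     (simp add: Cauchy_Schwarz_ineq2)

instantiation ell2 :: (complex_inner) complex_inner
begin

lift_definition zero_ell2 :: "'a ell2" is "\<lambda>_. 0" by simp
lift_definition plus_ell2 :: "'a ell2 \<Rightarrow> 'a ell2 \<Rightarrow> 'a ell2" is "\<lambda>f g i. f i + g i"
  by (rule summable_norm_sq_add)
lift_definition uminus_ell2 :: "'a ell2 \<Rightarrow> 'a ell2" is "\<lambda>f i. - f i" by simp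
lift_definition minus_ell2 :: "'a ell2 \<Rightarrow> 'a ell2 \<Rightarrow> 'a ell2" is "\<lambda>f g i. f i - g i"
  subgoal for f g using summable_norm_sq_add[of f "\<lambda>i. - g i"] by simp
  done
lift_definition scaleR_ell2 :: "real \<Rightarrow> 'a ell2 \<Rightarrow> 'a ell2" is "\<lambda>a f i. a *\<^sub>R f i"
  by (simp add: power_mult_distrib summable_mult)
lift_definition scaleC_ell2 :: "complex \<Rightarrow> 'a ell2 \<Rightarrow> 'a ell2" is "\<lambda>c f i. c *\<^sub>C f i"
  by (simp add: power_mult_distrib summable_mult norm_scaleC)
lift_definition inner_ell2 :: "'a ell2 \<Rightarrow> 'a ell2 \<Rightarrow> real" is "\<lambda>f g. \<Sum>i. inner (f i) (g i)" .
lift_definition cinner_ell2 :: "'a ell2 \<Rightarrow> 'a ell2 \<Rightarrow> complex" is "\<lambda>f g. \<Sum>i. cinner (f i) (g i)" .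

definition norm_ell2 :: "'a ell2 \<Rightarrow> real" where "norm_ell2 f = sqrt (inner f f)"
definition sgn_ell2 :: "'a ell2 \<Rightarrow> 'a ell2" where "sgn_ell2 f = scaleR (inverse (norm f)) f"
definition dist_ell2 :: "'a ell2 \<Rightarrow> 'a ell2 \<Rightarrow> real" where "dist_ell2 f g = norm (f - g)"
definition uniformity_ell2 :: "('a ell2 \<times> 'a ell2) filter" where
  "uniformity_ell2 = (INF e\<in>{0<..}. principal {(x, y). dist x y < e})"
definition open_ell2 :: "'a ell2 set \<Rightarrow> bool" where
  "open_ell2 U \<longleftrightarrow> (\<forall>x\<in>U. eventually (\<lambda>(x', y). x' = x \<longrightarrow> y \<in> U) uniformity)"

instance
proof
  fix f g h :: "'a ell2" and a b :: real and c d :: complex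
  show "f + g + h = f + (g + h)" "f + g = g + f" "0 + f = f" "- f + f = 0" "f - g = f + - g"
    by (transfer, simp add: algebra_simps)+
  show "a *\<^sub>R (f + g) = a *\<^sub>R f + a *\<^sub>R g" "(a + b) *\<^sub>R f = a *\<^sub>R f + b *\<^sub>R f"
    "a *\<^sub>R b *\<^sub>R f = (a * b) *\<^sub>R f" "1 *\<^sub>R f = f"
    by (transfer, simp add: algebra_simps)+
  show "c *\<^sub>C (f + g) = c *\<^sub>C f + c *\<^sub>C g" "(c + d) *\<^sub>C f = c *\<^sub>C f + d *\<^sub>C f"
    "c *\<^sub>C (d *\<^sub>C f) = (c * d) *\<^sub>C f" "complex_of_real a *\<^sub>C f = a *\<^sub>R f"
    by (transfer, simp add: scaleC_add_right scaleC_add_left scaleC_scaleC scaleC_of_real)+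
  show "sgn f = scaleR (inverse (norm f)) f" by (rule sgn_ell2_def)
  show "dist f g = norm (f - g)" by (rule dist_ell2_def)
  show "(uniformity :: ('a ell2 \<times> 'a ell2) filter) =
      (INF e\<in>{0<..}. principal {(x, y). dist x y < e})" by (rule uniformity_ell2_def)
  show "open U \<longleftrightarrow> (\<forall>x\<in>U. \<forall>\<^sub>F (x', y) in uniformity. x' = x \<longrightarrow> y \<in> U)"
    for U :: "'a ell2 set" by (rule open_ell2_def)
  show "inner f g = inner g f" by transfer (simp add: inner_commute)
  show "inner (f + g) h = inner f h + inner g h"
    by transfer (simp add: inner_add_left suminf_add summable_inner)
  show "inner (a *\<^sub>R f) g = a * inner f g"
    by transfer (simp add: suminf_mult summable_inner)
  show "0 \<le> inner f f" by transfer (simp add: suminf_nonneg summable_inner)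
  show "inner f f = 0 \<longleftrightarrow> f = 0"
  proof transfer
    fix f :: "nat \<Rightarrow> 'a" assume *: "summable (\<lambda>i. (norm (f i))\<^sup>2)"
    show "(\<Sum>i. inner (f i) (f i)) = 0 \<longleftrightarrow> f = (\<lambda>_. 0)"
      using suminf_eq_zero_iff[OF summable_inner[OF * *]] by auto
  qed
  show "norm f = sqrt (inner f f)" by (rule norm_ell2_def)
  show "cinner f g = cnj (cinner g f)"
  proof transfer
    fix f g :: "nat \<Rightarrow> 'a"
    assume "summable (\<lambda>i. (norm (f i))\<^sup>2)" "summable (\<lambda>i. (norm (g i))\<^sup>2)"
    then have "(\<lambda>i. cinner (g i) (f i)) sums (\<Sum>i. cinner (g i) (f i))"
      by (intro summable_sums summable_cinner)
    then have "(\<lambda>i. cnj (cinner (g i) (f i))) sums cnj (\<Sum>i. cinner (g i) (f i))"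
      by (simp only: sums_cnj)
    then have "(\<lambda>i. cinner (f i) (g i)) sums cnj (\<Sum>i. cinner (g i) (f i))"
      by (simp only: cinner_commute[symmetric])
    then show "(\<Sum>i. cinner (f i) (g i)) = cnj (\<Sum>i. cinner (g i) (f i))"
      by (rule sums_unique[symmetric])
  qed
  show "cinner (f + g) h = cinner f h + cinner g h"
    by transfer (simp add: cinner_add_left suminf_add summable_cinner)
  show "cinner (c *\<^sub>C f) g = c * cinner f g"
    by transfer (simp add: cinner_scaleC_left suminf_mult summable_cinner)
  show "Re (cinner f g) = inner f g"
    by transfer (simp add: Re_suminf summable_cinner Re_cinner)
qed

end

lemma summable_ell2_nth: "summable (\<lambda>i. (norm (ell2_nth f i))\<^sup>2)"
  using ell2_nth by blast

lemma norm_ell2_sq: "(norm f)\<^sup>2 = (\<Sum>i. (norm (ell2_nth f i))\<^sup>2)"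
  by (simp add: power2_norm_eq_inner inner_ell2.rep_eq)

lemma sum_le_norm_ell2_sq: "(\<Sum>i<m. (norm (ell2_nth f i))\<^sup>2) \<le> (norm f)\<^sup>2"
  unfolding norm_ell2_sq by (intro sum_le_suminf summable_ell2_nth) auto

lemma norm_ell2_nth_le: "norm (ell2_nth f i) \<le> norm f"
proof -
  have "(norm (ell2_nth f i))\<^sup>2 \<le> (\<Sum>i<Suc i. (norm (ell2_nth f i))\<^sup>2)"
    by (simp add: sum_nonneg)
  also have "\<dots> \<le> (norm f)\<^sup>2" by (rule sum_le_norm_ell2_sq)
  finally show ?thesis by (rule power2_le_imp_le) simp
qed

instance ell2 :: (chilbert_space) chilbert_space
proof
  fix X :: "nat \<Rightarrow> 'a ell2"
  assume X: "Cauchy X"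
  have "Cauchy (\<lambda>n. ell2_nth (X n) i)" for i
  proof (rule metric_CauchyI)
    fix e :: real assume "e > 0"
    then obtain M where M: "\<forall>m\<ge>M. \<forall>n\<ge>M. dist (X m) (X n) < e"
      using X metric_CauchyD by blast
    have "dist (ell2_nth (X m) i) (ell2_nth (X n) i) \<le> dist (X m) (X n)" for m n
      using norm_ell2_nth_le[of "X m - X n" i] by (simp add: dist_norm minus_ell2.rep_eq)
    with M show "\<exists>M. \<forall>m\<ge>M. \<forall>n\<ge>M. dist (ell2_nth (X m) i) (ell2_nth (X n) i) < e"
      by (meson le_less_trans)
  qed
  then have "\<exists>l. (\<lambda>n. ell2_nth (X n) i) \<longlonglongrightarrow> l" for i
    using Cauchy_convergent convergent_def by blast
  then obtain L where L: "\<And>i. (\<lambda>n. ell2_nth (X n) i) \<longlonglongrightarrow> L i" by metis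
  have tail: "summable (\<lambda>i. (norm (ell2_nth (X n) i - L i))\<^sup>2)"
      "(\<Sum>i. (norm (ell2_nth (X n) i - L i))\<^sup>2) \<le> e\<^sup>2"
    if "e > 0" and M: "\<forall>m\<ge>M. dist (X n) (X m) < e" for e n M
  proof -
    have bd: "(\<Sum>i<k. (norm (ell2_nth (X n) i - L i))\<^sup>2) \<le> e\<^sup>2" for k
    proof (rule LIMSEQ_le_const2)
      show "(\<lambda>m. \<Sum>i<k. (norm (ell2_nth (X n) i - ell2_nth (X m) i))\<^sup>2)
          \<longlonglongrightarrow> (\<Sum>i<k. (norm (ell2_nth (X n) i - L i))\<^sup>2)"
        by (intro tendsto_intros L)
      have "(\<Sum>i<k. (norm (ell2_nth (X n) i - ell2_nth (X m) i))\<^sup>2) \<le> e\<^sup>2" if "m \<ge> M" for m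
      proof -
        have "(\<Sum>i<k. (norm (ell2_nth (X n) i - ell2_nth (X m) i))\<^sup>2) \<le> (norm (X n - X m))\<^sup>2"
          using sum_le_norm_ell2_sq[of "X n - X m" k] by (simp add: minus_ell2.rep_eq)
        also have "\<dots> \<le> e\<^sup>2"
          using M that by (intro power_mono) (auto simp: dist_norm less_imp_le)
        finally show ?thesis .
      qed
      then show "\<exists>N. \<forall>m\<ge>N. (\<Sum>i<k. (norm (ell2_nth (X n) i - ell2_nth (X m) i))\<^sup>2) \<le> e\<^sup>2"
        by blast
    qed
    show "summable (\<lambda>i. (norm (ell2_nth (X n) i - L i))\<^sup>2)"
      by (rule summableI_nonneg_bounded[OF _ bd]) simp
    then show "(\<Sum>i. (norm (ell2_nth (X n) i - L i))\<^sup>2) \<le> e\<^sup>2"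
      using bd by (rule suminf_le_const)
  qed
  obtain M where "\<forall>m\<ge>M. \<forall>n\<ge>M. dist (X m) (X n) < 1"
    using X metric_CauchyD zero_less_one by blast
  then have "summable (\<lambda>i. (norm (ell2_nth (X M) i - L i))\<^sup>2)"
    using tail(1)[of 1 M M] by simp
  from summable_norm_sq_add[OF summable_ell2_nth[of "- X M"] this]
  have "summable (\<lambda>i. (norm (L i))\<^sup>2)" by (simp add: uminus_ell2.rep_eq)
  then have nthL: "ell2_nth (Abs_ell2 L) = L" by (simp add: Abs_ell2_inverse)
  have "X \<longlonglongrightarrow> Abs_ell2 L"
  proof (rule metric_LIMSEQ_I)
    fix e :: real assume e: "e > 0"
    then obtain M where M: "\<forall>m\<ge>M. \<forall>n\<ge>M. dist (X m) (X n) < e / 2"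
      using X metric_CauchyD half_gt_zero by blast
    have "dist (X n) (Abs_ell2 L) < e" if "n \<ge> M" for n
    proof -
      have "(norm (X n - Abs_ell2 L))\<^sup>2 \<le> (e / 2)\<^sup>2"
        using tail(2)[of "e / 2" M n] M that e by (simp add: norm_ell2_sq minus_ell2.rep_eq nthL)
      then have "norm (X n - Abs_ell2 L) \<le> e / 2"
        by (rule power2_le_imp_le) (use e in simp)
      then show ?thesis using e by (simp add: dist_norm)
    qed
    then show "\<exists>no. \<forall>n\<ge>no. dist (X n) (Abs_ell2 L) < e" by blast
  qed
  then show "convergent X" by (rule convergentI)
qed


section \<open>Bounded operators\<close>

text \<open>
  \<open>\<B>(\<H>)\<close> consists of the complex-linear elements of the library type of
  bounded real-linear maps, whose norm is the operator norm.  On a Hilbert space the adjoint of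
  such an element exists and is unique (Riesz), so the definite description below is meaningful
  there.
\<close>

definition bounded_ops :: "('a::complex_inner \<Rightarrow>\<^sub>L 'a) set" where
  "bounded_ops = {T. \<forall>c x. blinfun_apply T (c *\<^sub>C x) = c *\<^sub>C blinfun_apply T x}"

definition cadjoint :: "('a::complex_inner \<Rightarrow>\<^sub>L 'a) \<Rightarrow> ('a \<Rightarrow>\<^sub>L 'a)" where
  "cadjoint T = (THE S. \<forall>x y. cinner (blinfun_apply T x) y = cinner x (blinfun_apply S y))"

definition positive_invertible :: "('a::complex_inner \<Rightarrow>\<^sub>L 'a) \<Rightarrow> bool" where
  "positive_invertible T \<longleftrightarrow>
     (\<forall>x. cinner (blinfun_apply T x) x \<in> \<real>\<^sub>\<ge>\<^sub>0) \<and>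
     (\<exists>S. S o\<^sub>L T = id_blinfun \<and> T o\<^sub>L S = id_blinfun)"


section \<open>Hilbert space tensor products\<close>

text \<open>
  \<open>hilbert_tensor tens\<close>: the space \<open>'e\<close> together with \<open>tens\<close> is a Hilbert space tensor product of
  \<open>'k\<close> and \<open>'h\<close>.  This determines \<open>'e\<close> up to a unique unitary preserving elementary tensors.  The
  set of elementary tensors is closed under complex scalars, so its real span is its complex span.
\<close>

definition hilbert_tensor ::
    "('k::chilbert_space \<Rightarrow> 'h::chilbert_space \<Rightarrow> 'e::chilbert_space) \<Rightarrow> bool" where
  "hilbert_tensor tens \<longleftrightarrow>
     (\<forall>x x' y. tens (x + x') y = tens x y + tens x' y) \<and>
     (\<forall>x y y'. tens x (y + y') = tens x y + tens x y') \<and>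
     (\<forall>c x y. tens (c *\<^sub>C x) y = c *\<^sub>C tens x y \<and> tens x (c *\<^sub>C y) = c *\<^sub>C tens x y) \<and>
     (\<forall>x x' y y'. cinner (tens x y) (tens x' y') = cinner x x' * cinner y y') \<and>
     closure (span {tens x y | x y. True}) = UNIV"

text \<open>
  \<open>A \<otimes> X\<close> is the unique bounded operator with \<open>(A \<otimes> X) (x \<otimes> y) = A x \<otimes> X y\<close>; it exists for all
  \<open>A\<close> and \<open>X\<close> in \<open>bounded_ops\<close>.
\<close>

definition op_tensor ::
    "('k::chilbert_space \<Rightarrow> 'h::chilbert_space \<Rightarrow> 'e::chilbert_space) \<Rightarrow>
      ('k \<Rightarrow>\<^sub>L 'k) \<Rightarrow> ('h \<Rightarrow>\<^sub>L 'h) \<Rightarrow> ('e \<Rightarrow>\<^sub>L 'e)" where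
  "op_tensor tens A X =
     (THE T. T \<in> bounded_ops \<and>
       (\<forall>x y. blinfun_apply T (tens x y) = tens (blinfun_apply A x) (blinfun_apply X y)))"

text \<open>The standard model of the tensor product of \<open>'k\<close> with scalar square summable sequences.\<close>

lemma hilbert_tensor_ell2:
  "hilbert_tensor (\<lambda>(x::'k::chilbert_space) (y::complex ell2). Abs_ell2 (\<lambda>i. ell2_nth y i *\<^sub>C x))"
proof -
  define t where "t = (\<lambda>(x::'k) (y::complex ell2). Abs_ell2 (\<lambda>i. ell2_nth y i *\<^sub>C x))"
  have "summable (\<lambda>i. (norm (ell2_nth y i *\<^sub>C x))\<^sup>2)" for x :: 'k and y
    using summable_mult2[OF summable_ell2_nth[of y], of "(norm x)\<^sup>2"]
    by (simp add: norm_scaleC power_mult_distrib)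
  then have nth: "ell2_nth (t x y) = (\<lambda>i. ell2_nth y i *\<^sub>C x)" for x y
    by (simp add: t_def Abs_ell2_inverse)
  have dense: "f \<in> closure (span {t x y | x y. True})" for f
  proof -
    define g where "g m = Abs_ell2 (\<lambda>i. if i < m then ell2_nth f i else 0)" for m
    have "summable (\<lambda>i. (norm (if i < m then ell2_nth f i else 0))\<^sup>2)" for m
      by (rule summable_finite[of "{..<m}"]) auto
    then have nth_g: "ell2_nth (g m) = (\<lambda>i. if i < m then ell2_nth f i else 0)" for m
      by (simp add: g_def Abs_ell2_inverse)
    define u where "u m = (Abs_ell2 (\<lambda>i. if i = m then 1 else 0) :: complex ell2)" for m :: nat
    have "summable (\<lambda>i. (norm (if i = m then 1 else 0 :: complex))\<^sup>2)" for m :: nat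
      by (rule summable_finite[of "{m}"]) auto
    then have nth_u: "ell2_nth (u m) = (\<lambda>i. if i = m then 1 else 0)" for m
      by (simp add: u_def Abs_ell2_inverse)
    have c1: "(1::complex) *\<^sub>C x = x" and c0: "(0::complex) *\<^sub>C x = 0" for x :: 'k
      using scaleC_of_real[of 1 x] scaleC_of_real[of 0 x] by simp_all
    have nth_tu: "ell2_nth (t (ell2_nth f m) (u m)) i = (if i = m then ell2_nth f m else 0)" for m i
      by (simp add: nth nth_u c0 c1)
    have step: "g (Suc m) = g m + t (ell2_nth f m) (u m)" for m
      by (subst ell2_nth_inject[symmetric])
         (auto simp: fun_eq_iff plus_ell2.rep_eq nth_tu nth_g)
    have "g 0 = 0" by (subst ell2_nth_inject[symmetric]) (simp add: nth_g zero_ell2.rep_eq)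
    then have in_span: "g m \<in> span {t x y | x y. True}" for m
    proof (induction m)
      case (Suc m)
      then have "g m \<in> span {t x y | x y. True}" by blast
      moreover have "t (ell2_nth f m) (u m) \<in> span {t x y | x y. True}"
        by (rule span_base) blast
      ultimately show ?case unfolding step by (rule span_add)
    qed (simp add: span_zero)
    have eq: "(norm (f - g m))\<^sup>2 = (\<Sum>i. (norm (ell2_nth f (i + m)))\<^sup>2)" for m
    proof -
      have "(norm (f - g m))\<^sup>2 = (\<Sum>i. (norm (ell2_nth (f - g m) (i + m)))\<^sup>2)
          + (\<Sum>i<m. (norm (ell2_nth (f - g m) i))\<^sup>2)"
        unfolding norm_ell2_sq by (rule suminf_split_initial_segment[OF summable_ell2_nth])
      then show ?thesis by (simp add: minus_ell2.rep_eq nth_g)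
    qed
    have "(\<lambda>m. (norm (f - g m))\<^sup>2) \<longlonglongrightarrow> 0"
      unfolding eq by (rule suminf_exist_split2[OF summable_ell2_nth])
    then have "(\<lambda>m. sqrt ((norm (f - g m))\<^sup>2)) \<longlonglongrightarrow> sqrt 0" by (rule tendsto_real_sqrt)
    then have "(\<lambda>m. norm (g m - f)) \<longlonglongrightarrow> 0" by (simp add: norm_minus_commute)
    then have "g \<longlonglongrightarrow> f" by (simp add: tendsto_norm_zero_iff LIM_zero_iff)
    then show ?thesis unfolding closure_sequential using in_span by blast
  qed
  have "cinner (t x y) (t x' y') = cinner x x' * cinner y y'" for x x' y y'
  proof -
    have "cinner (t x y) (t x' y')
        = (\<Sum>i. cinner x x' * cinner (ell2_nth y i) (ell2_nth y' i))"
      by (simp add: cinner_ell2.rep_eq nth cinner_scaleC_left cinner_scaleC_right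
          cinner_complex_def mult_ac)
    also have "\<dots> = cinner x x' * cinner y y'"
      by (simp add: suminf_mult summable_cinner[OF summable_ell2_nth summable_ell2_nth]
          cinner_ell2.rep_eq)
    finally show ?thesis .
  qed
  moreover have "t (x + x') y = t x y + t x' y" "t x (y + y') = t x y + t x y'"
      "t (c *\<^sub>C x) y = c *\<^sub>C t x y" "t x (c *\<^sub>C y) = c *\<^sub>C t x y" for x x' y y' c
    by (simp_all add: ell2_nth_inject[symmetric] fun_eq_iff nth plus_ell2.rep_eq scaleC_ell2.rep_eq
        scaleC_add_left scaleC_add_right scaleC_scaleC scaleC_complex_def mult_ac)
  ultimately have "hilbert_tensor t" unfolding hilbert_tensor_def using dense by blast
  then show ?thesis unfolding t_def .
qed


section \<open>The regular polyball\<close>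

text \<open>
  Indices start at 0: \<open>i < k\<close> and \<open>j < n i\<close>.  A tuple is a function \<open>X\<close> with \<open>X i j = 0\<close> outside this
  range.  Hence the library's \<open>closure\<close> on function types (product topology) is the operator norm
  closure of a set of tuples.
\<close>

definition cp_map :: "nat \<Rightarrow> (nat \<Rightarrow> 'h::complex_inner \<Rightarrow>\<^sub>L 'h) \<Rightarrow> ('h \<Rightarrow>\<^sub>L 'h) \<Rightarrow> ('h \<Rightarrow>\<^sub>L 'h)" where
  "cp_map m Xi Y = (\<Sum>j<m. Xi j o\<^sub>L Y o\<^sub>L cadjoint (Xi j))"

definition defect_map ::
    "nat \<Rightarrow> (nat \<Rightarrow> nat) \<Rightarrow> (nat \<Rightarrow> nat \<Rightarrow> 'h::complex_inner \<Rightarrow>\<^sub>L 'h) \<Rightarrow> ('h \<Rightarrow>\<^sub>L 'h) \<Rightarrow> ('h \<Rightarrow>\<^sub>L 'h)" where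
  "defect_map k n X = foldr (\<lambda>i F. (\<lambda>Y. Y - cp_map (n i) (X i) Y) \<circ> F) [0..<k] id"

definition commuting_tuples ::
    "nat \<Rightarrow> (nat \<Rightarrow> nat) \<Rightarrow> (nat \<Rightarrow> nat \<Rightarrow> 'h::complex_inner \<Rightarrow>\<^sub>L 'h) set" where
  "commuting_tuples k n = {X.
     (\<forall>i j. if i < k \<and> j < n i then X i j \<in> bounded_ops else X i j = 0) \<and>
     (\<forall>s<k. \<forall>t<k. s \<noteq> t \<longrightarrow> (\<forall>p<n s. \<forall>q<n t. X s p o\<^sub>L X t q = X t q o\<^sub>L X s p))}"

definition polyball ::
    "nat \<Rightarrow> (nat \<Rightarrow> nat) \<Rightarrow> (nat \<Rightarrow> nat \<Rightarrow> 'h::complex_inner \<Rightarrow>\<^sub>L 'h) set" where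
  "polyball k n = {X \<in> commuting_tuples k n.
     (\<forall>i<k. norm (\<Sum>j<n i. X i j o\<^sub>L cadjoint (X i j)) < 1) \<and>
     positive_invertible (defect_map k n X id_blinfun)}"

definition polyscale ::
    "(nat \<Rightarrow> real) \<Rightarrow> (nat \<Rightarrow> nat \<Rightarrow> 'h::complex_inner \<Rightarrow>\<^sub>L 'h) \<Rightarrow> (nat \<Rightarrow> nat \<Rightarrow> 'h \<Rightarrow>\<^sub>L 'h)" where
  "polyscale r X = (\<lambda>i j. r i *\<^sub>R X i j)"


section \<open>Power series\<close>

text \<open>
  A word in the free semigroup on \<open>n i\<close> generators is a list over \<open>{..<n i}\<close>.  A formal power series
  is identified with its family of coefficients, indexed by \<open>multiwords k n\<close>.
\<close>

definition multidegrees :: "nat \<Rightarrow> (nat \<Rightarrow> nat) set" where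
  "multidegrees k = (\<Pi>\<^sub>E i\<in>{..<k}. UNIV)"

definition multiwords :: "nat \<Rightarrow> (nat \<Rightarrow> nat) \<Rightarrow> (nat \<Rightarrow> nat list) set" where
  "multiwords k n = (\<Pi>\<^sub>E i\<in>{..<k}. lists {..<n i})"

definition multiwords_of_degree ::
    "nat \<Rightarrow> (nat \<Rightarrow> nat) \<Rightarrow> (nat \<Rightarrow> nat) \<Rightarrow> (nat \<Rightarrow> nat list) set" where
  "multiwords_of_degree k n p = {\<alpha> \<in> multiwords k n. \<forall>i<k. length (\<alpha> i) = p i}"

definition word_op :: "(nat \<Rightarrow> 'h::complex_inner \<Rightarrow>\<^sub>L 'h) \<Rightarrow> nat list \<Rightarrow> ('h \<Rightarrow>\<^sub>L 'h)" where
  "word_op Xi w = foldr (\<lambda>j T. Xi j o\<^sub>L T) w id_blinfun"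

definition multiword_op ::
    "nat \<Rightarrow> (nat \<Rightarrow> nat \<Rightarrow> 'h::complex_inner \<Rightarrow>\<^sub>L 'h) \<Rightarrow> (nat \<Rightarrow> nat list) \<Rightarrow> ('h \<Rightarrow>\<^sub>L 'h)" where
  "multiword_op k X \<alpha> = foldr (\<lambda>i T. word_op (X i) (\<alpha> i) o\<^sub>L T) [0..<k] id_blinfun"

definition homogeneous_part ::
    "('k::chilbert_space \<Rightarrow> 'h::chilbert_space \<Rightarrow> 'e::chilbert_space) \<Rightarrow> nat \<Rightarrow> (nat \<Rightarrow> nat) \<Rightarrow>
      ((nat \<Rightarrow> nat list) \<Rightarrow> 'k \<Rightarrow>\<^sub>L 'k) \<Rightarrow> (nat \<Rightarrow> nat \<Rightarrow> 'h \<Rightarrow>\<^sub>L 'h) \<Rightarrow> (nat \<Rightarrow> nat) \<Rightarrow> ('e \<Rightarrow>\<^sub>L 'e)" where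
  "homogeneous_part tens k n A X p =
     (\<Sum>\<alpha>\<in>multiwords_of_degree k n p. op_tensor tens (A \<alpha>) (multiword_op k X \<alpha>))"

definition coefficient_norms ::
    "nat \<Rightarrow> (nat \<Rightarrow> nat) \<Rightarrow> (nat \<Rightarrow> real) \<Rightarrow> ((nat \<Rightarrow> nat list) \<Rightarrow> 'k::chilbert_space \<Rightarrow>\<^sub>L 'k) \<Rightarrow> real set" where
  "coefficient_norms k n r A =
     {norm ((\<Prod>i<k. r i ^ (2 * p i)) *\<^sub>R
        (\<Sum>\<alpha>\<in>multiwords_of_degree k n p. cadjoint (A \<alpha>) o\<^sub>L A \<alpha>)) | p. p \<in> multidegrees k}"

end

theory Submission
  imports Defs
begin

text \<open>
  The homogeneous part \<open>\<Sum>\<^sub>\<alpha> A\<^sub>\<alpha> \<otimes> X\<^sub>\<alpha>\<close> of multidegree \<open>p\<close> is a row times a column: the row consists of the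
  operators \<open>I \<otimes> X\<^sub>\<alpha>\<close>, the column of the operators \<open>A\<^sub>\<alpha> \<otimes> I\<close>.  The column has squared norm
  \<open>\<parallel>\<Sum>\<^sub>\<alpha> A\<^sub>\<alpha>\<^sup>* A\<^sub>\<alpha>\<parallel>\<close>.  The row is a product of rows of letters, \<open>p i\<close> factors for each \<open>i\<close>, so if the row
  \<open>(X\<^sub>i\<^sub>,\<^sub>j)\<^sub>j\<close> has squared norm at most \<open>(r\<^sub>i q\<^sub>i)\<^sup>2\<close>, then the homogeneous part has norm at most \<open>sqrt M * \<Prod>\<^sub>i q\<^sub>i ^ p\<^sub>i\<close>,
  where \<open>M\<close> bounds the coefficient norms (\<open>homogeneous_part_bound\<close>).  When all \<open>q\<^sub>i < 1\<close> this is a convergent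
  geometric multiseries.  For \<open>X = r Y\<close> with \<open>Y\<close> in the polyball, \<open>q\<^sub>i\<close> is the norm of the row \<open>Y\<^sub>i\<close>; for
  \<open>X\<close> in \<open>s\<close> times the closed polyball, \<open>q\<^sub>i = s\<^sub>i / r\<^sub>i\<close> serves for all \<open>X\<close> at once, and the Weierstrass test
  gives uniform convergence.

  Conversely, let \<open>X\<close> be \<open>r\<close> times the tuple of creation operators on the tensor product of full Fock
  spaces, realized on square summable sequences by numbering the multiwords.  The operators \<open>X\<^sub>\<alpha>\<close> with
  \<open>\<alpha>\<close> of multidegree \<open>p\<close> send the vacuum vector to orthogonal vectors of norm \<open>\<Prod>\<^sub>i r\<^sub>i ^ p\<^sub>i\<close>, so here the
  estimate of the homogeneous part by the coefficient norm can be reversed (\<open>homogeneous_part_creation\<close>).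
  If the coefficient norms are unbounded, the terms of both series are unbounded at this \<open>X\<close>, and
  neither series can converge.  The creation operators lie in the closed polyball because their multiples by
  \<open>t < 1\<close> have rows of squared norm at most \<open>t\<^sup>2\<close> and diagonal defect operators with entries at least
  \<open>(1 - t\<^sup>2) ^ k\<close>.
\<close>


section \<open>Riesz representation and adjoints\<close>

lemma parallelogram_midpoint:
  fixes x y :: "'a::real_inner"
  shows "(norm (x - y))\<^sup>2 = 2 * (norm x)\<^sup>2 + 2 * (norm y)\<^sup>2 - 4 * (norm ((1/2) *\<^sub>R (x + y)))\<^sup>2"
  by (simp add: power2_norm_eq_inner algebra_simps inner_commute)

text \<open>
  The functional \<open>J x = \<parallel>x\<parallel>\<^sup>2 - 2 f x\<close> is bounded below, and by the parallelogram law every minimizing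
  sequence is Cauchy.  Its limit minimizes \<open>J\<close>, and the vanishing of the first variation there is
  the representation of \<open>f\<close>.
\<close>

lemma riesz_representation:
  fixes f :: "'a::{real_inner,complete_space} \<Rightarrow> real"
  assumes f: "bounded_linear f"
  shows "\<exists>z. \<forall>x. f x = inner z x"
proof -
  interpret bounded_linear f by (rule f)
  define J where "J x = (norm x)\<^sup>2 - 2 * f x" for x
  obtain K where K: "\<And>x. norm (f x) \<le> norm x * K" using bounded by blast
  have lower: "- K\<^sup>2 \<le> J x" for x
  proof -
    have "f x \<le> norm x * K" using K[of x] by simp
    moreover have "0 \<le> (norm x - K)\<^sup>2" by simp
    ultimately show ?thesis unfolding J_def power2_diff by linarith
  qed
  define d where "d = Inf (range J)"
  have bdd: "bdd_below (range J)" using lower by (intro bdd_belowI[of _ "- K\<^sup>2"]) auto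
  have d_le: "d \<le> J x" for x unfolding d_def using bdd by (auto intro: cInf_lower)
  have "\<exists>x. J x < d + e" if "e > 0" for e
    using that cInf_lessD[of "range J" "d + e"] unfolding d_def by auto
  then have "\<exists>x. J x < d + 1 / real (Suc m)" for m by simp
  then obtain x where x: "\<And>m. J (x m) < d + 1 / real (Suc m)" by metis
  have midpoint: "(norm (a - b))\<^sup>2 \<le> 2 * (J a - d) + 2 * (J b - d)" for a b
  proof -
    have "(norm (a - b))\<^sup>2 = 2 * J a + 2 * J b - 4 * J ((1/2) *\<^sub>R (a + b))"
      unfolding parallelogram_midpoint[of a b] J_def by (simp add: scaleR add field_simps)
    then show ?thesis using d_le[of "(1/2) *\<^sub>R (a + b)"] by simp
  qed
  have "Cauchy x"
  proof (rule metric_CauchyI)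
    fix e :: real assume e: "e > 0"
    obtain M where M: "4 / e\<^sup>2 < real M" using reals_Archimedean2 by blast
    have "norm (x m - x m') < e" if "m \<ge> M" "m' \<ge> M" for m m'
    proof -
      have pos: "0 < 4 / e\<^sup>2" using e by simp
      have small: "4 * (J (x l) - d) < e\<^sup>2" if "l \<ge> M" for l
      proof -
        have "4 / e\<^sup>2 < real (Suc l)" using M that by linarith
        then have "4 * (1 / real (Suc l)) < e\<^sup>2" using e by (simp add: field_simps)
        then show ?thesis using x[of l] by argo
      qed
      have "(norm (x m - x m'))\<^sup>2 < e\<^sup>2"
        using midpoint[of "x m" "x m'"] small[OF that(1)] small[OF that(2)]
        by argo
      then show ?thesis using e by (simp add: power_less_imp_less_base)
    qed
    then show "\<exists>M. \<forall>m\<ge>M. \<forall>n\<ge>M. dist (x m) (x n) < e" by (auto simp: dist_norm)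
  qed
  then obtain z where z: "x \<longlonglongrightarrow> z" using Cauchy_convergent convergent_def by blast
  have "(\<lambda>m. J (x m)) \<longlonglongrightarrow> J z"
    unfolding J_def by (intro tendsto_intros z tendsto)
  moreover have "(\<lambda>m. d + 1 / real (Suc m)) \<longlonglongrightarrow> d"
    using tendsto_add[OF tendsto_const LIMSEQ_inverse_real_of_nat, of d]
    by (simp add: inverse_eq_divide)
  ultimately have Jz: "J z \<le> d"
    by (rule LIMSEQ_le) (use x less_imp_le in blast)
  have "f h = inner z h" for h
  proof (cases "h = 0")
    case False
    define a where "a = inner z h - f h"
    define t where "t = - a / (norm h)\<^sup>2"
    have "J z \<le> J (z + t *\<^sub>R h)" using Jz d_le order_trans by blast
    also have "J (z + t *\<^sub>R h) = J z + t\<^sup>2 * (norm h)\<^sup>2 + 2 * t * a"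
      unfolding J_def a_def add scaleR power2_norm_eq_inner
      by (simp add: algebra_simps inner_commute power2_eq_square)
    finally have "0 \<le> t\<^sup>2 * (norm h)\<^sup>2 + 2 * t * a" by simp
    also have "\<dots> = - (a\<^sup>2 / (norm h)\<^sup>2)"
      using False by (simp add: t_def power2_eq_square field_simps)
    finally have "a\<^sup>2 / (norm h)\<^sup>2 \<le> 0" by simp
    then have "a = 0" using False by (simp add: divide_le_0_iff)
    then show ?thesis by (simp add: a_def)
  qed (simp add: zero)
  then show ?thesis by blast
qed

lemma scaleC_zero_left [simp]: "0 *\<^sub>C x = 0"
  using scaleC_of_real[of 0 x] by simp

lemma scaleC_zero_right [simp]: "c *\<^sub>C 0 = 0"
  using norm_scaleC[of c 0] by simp

lemma scaleC_one [simp]: "1 *\<^sub>C x = x"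
  using scaleC_of_real[of 1 x] by simp

lemma cinner_zero_left [simp]: "cinner 0 y = 0"
  using cinner_scaleC_left[of 0 0 y] by simp

lemma cinner_zero_right [simp]: "cinner x 0 = 0"
  using cinner_scaleC_right[of x 0 0] by simp

lemma cinner_minus_left: "cinner (x - y) z = cinner x z - cinner y z"
  using cinner_add_left[of "x - y" y z] by simp

lemma cinner_minus_right: "cinner z (x - y) = cinner z x - cinner z y"
  using cinner_add_right[of z "x - y" y] by simp

lemma cinner_sum_left: "cinner (\<Sum>i\<in>I. f i) y = (\<Sum>i\<in>I. cinner (f i) y)"
  by (induction I rule: infinite_finite_induct) (simp_all add: cinner_add_left)

lemma cinner_sum_right: "cinner y (\<Sum>i\<in>I. f i) = (\<Sum>i\<in>I. cinner y (f i))"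
  by (induction I rule: infinite_finite_induct) (simp_all add: cinner_add_right)

lemma cinner_eqI: "a = b" if "\<And>x. cinner x a = cinner x b"
proof -
  have "cinner (a - b) (a - b) = 0"
    using that[of "a - b"] by (simp add: cinner_minus_right)
  then show ?thesis by (simp add: cinner_self)
qed

lemma Im_cinner: "Im (cinner x y) = - inner (\<i> *\<^sub>C x) y"
  using Re_cinner[of "\<i> *\<^sub>C x" y] by (simp add: cinner_scaleC_left)

lemma bounded_opsD: "T \<in> bounded_ops \<Longrightarrow> blinfun_apply T (c *\<^sub>C x) = c *\<^sub>C blinfun_apply T x"
  by (simp add: bounded_ops_def)

lemma adjoint_exists:
  fixes T :: "'a::chilbert_space \<Rightarrow>\<^sub>L 'a"
  assumes T: "T \<in> bounded_ops"
  shows "\<exists>S\<in>bounded_ops. \<forall>x y. cinner (blinfun_apply T x) y = cinner x (blinfun_apply S y)"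
proof -
  have "bounded_linear (\<lambda>x. inner (blinfun_apply T x) y)" for y
    by (intro bounded_linear_intros)
  then have "\<exists>z. \<forall>x. inner (blinfun_apply T x) y = inner z x" for y
    by (rule riesz_representation)
  then obtain S where S: "\<And>x y. inner (blinfun_apply T x) y = inner (S y) x" by metis
  have cS: "cinner (blinfun_apply T x) y = cinner x (S y)" for x y
    using S[of x y] S[of "\<i> *\<^sub>C x" y]
    by (intro complex_eqI) (simp_all add: Re_cinner Im_cinner bounded_opsD[OF T] inner_commute)
  have add: "S (x + y) = S x + S y" for x y
    by (rule cinner_eqI) (simp add: cinner_add_right flip: cS)
  have sc: "S (c *\<^sub>C x) = c *\<^sub>C S x" for c x
    by (rule cinner_eqI) (simp add: cinner_scaleC_right flip: cS)
  have bl: "bounded_linear S"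
  proof (rule bounded_linear_intro)
    show "S (a *\<^sub>R x) = a *\<^sub>R S x" for a x
      using sc[of "complex_of_real a" x] by (simp add: scaleC_of_real)
    show "norm (S y) \<le> norm y * norm T" for y
    proof (cases "S y = 0")
      case False
      have "norm (S y) * norm (S y) = inner (blinfun_apply T (S y)) y"
        using S[of "S y" y] by (simp flip: power2_norm_eq_inner power2_eq_square)
      also have "\<dots> \<le> norm (blinfun_apply T (S y)) * norm y"
        by (rule norm_cauchy_schwarz)
      also have "\<dots> \<le> (norm T * norm (S y)) * norm y"
        by (intro mult_right_mono norm_blinfun) auto
      finally show ?thesis using False by (simp add: mult.commute mult.left_commute)
    qed simp
  qed (rule add)
  have app: "blinfun_apply (Blinfun S) = S" by (rule bounded_linear_Blinfun_apply[OF bl])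
  show ?thesis
    by (rule bexI[of _ "Blinfun S"]) (simp_all add: app cS bounded_ops_def sc)
qed

lemma cadjoint_eqI:
  assumes "\<And>x y. cinner (blinfun_apply T x) y = cinner x (blinfun_apply S y)"
  shows "cadjoint T = S"
  unfolding cadjoint_def
proof (rule the_equality)
  fix S' assume "\<forall>x y. cinner (blinfun_apply T x) y = cinner x (blinfun_apply S' y)"
  then have "cinner x (blinfun_apply S' y) = cinner x (blinfun_apply S y)" for x y
    using assms by simp
  then show "S' = S" by (metis blinfun_eqI cinner_eqI)
qed (simp add: assms)

lemma
  fixes T :: "'a::chilbert_space \<Rightarrow>\<^sub>L 'a"
  assumes "T \<in> bounded_ops"
  shows cadjoint_bounded_ops: "cadjoint T \<in> bounded_ops"
    and cinner_cadjoint: "cinner (blinfun_apply T x) y = cinner x (blinfun_apply (cadjoint T) y)"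
proof -
  obtain S where S: "S \<in> bounded_ops"
      "\<And>x y. cinner (blinfun_apply T x) y = cinner x (blinfun_apply S y)"
    using adjoint_exists[OF assms] by blast
  have "cadjoint T = S" by (rule cadjoint_eqI) (rule S(2))
  then show "cadjoint T \<in> bounded_ops"
      "cinner (blinfun_apply T x) y = cinner x (blinfun_apply (cadjoint T) y)"
    using S by simp_all
qed

lemma cadjoint_cadjoint:
  fixes T :: "'a::chilbert_space \<Rightarrow>\<^sub>L 'a"
  assumes "T \<in> bounded_ops"
  shows "cadjoint (cadjoint T) = T"
proof (rule cadjoint_eqI)
  fix x y
  have "cinner (blinfun_apply (cadjoint T) x) y = cnj (cinner y (blinfun_apply (cadjoint T) x))"
    by (rule cinner_commute)
  also have "\<dots> = cnj (cinner (blinfun_apply T y) x)" by (simp only: cinner_cadjoint[OF assms])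
  also have "\<dots> = cinner x (blinfun_apply T y)" by (rule cinner_commute[symmetric])
  finally show "cinner (blinfun_apply (cadjoint T) x) y = cinner x (blinfun_apply T y)" .
qed

lemma cadjoint_scaleR:
  fixes T :: "'a::chilbert_space \<Rightarrow>\<^sub>L 'a"
  assumes "T \<in> bounded_ops"
  shows "cadjoint (a *\<^sub>R T) = a *\<^sub>R cadjoint T"
  by (rule cadjoint_eqI)
     (simp add: cinner_cadjoint[OF assms] blinfun.scaleR_left cinner_scaleC_left cinner_scaleC_right
       flip: scaleC_of_real)

text \<open>
  \<open>B = \<Sum>\<^sub>i (A i)\<^sup>* (A i)\<close> is positive, so its norm is controlled by its quadratic form: Cauchy-Schwarz for the
  form \<open>\<langle>B x, y\<rangle>\<close>, evaluated at \<open>y = B x\<close>.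
\<close>

lemma norm_sum_le_if_columns_bounded:
  fixes A :: "'i \<Rightarrow> 'a::chilbert_space \<Rightarrow>\<^sub>L 'a"
  assumes A: "\<And>i. i \<in> I \<Longrightarrow> A i \<in> bounded_ops"
    and "0 \<le> M" and M: "\<And>x. (\<Sum>i\<in>I. (norm (blinfun_apply (A i) x))\<^sup>2) \<le> M * (norm x)\<^sup>2"
  shows "norm (\<Sum>i\<in>I. cadjoint (A i) o\<^sub>L A i) \<le> M"
proof (rule norm_blinfun_bound)
  fix x
  define B where "B = (\<Sum>i\<in>I. cadjoint (A i) o\<^sub>L A i)"
  define y where "y = blinfun_apply B x"
  have "inner y y = (\<Sum>i\<in>I. inner (blinfun_apply (A i) x) (blinfun_apply (A i) y))"
  proof -
    have "cinner y y = (\<Sum>i\<in>I. cinner y (blinfun_apply (cadjoint (A i)) (blinfun_apply (A i) x)))"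
      by (subst (2) y_def) (simp add: B_def blinfun.sum_left cinner_sum_right)
    also have "\<dots> = (\<Sum>i\<in>I. cinner (blinfun_apply (A i) y) (blinfun_apply (A i) x))"
      by (intro sum.cong refl cinner_cadjoint[symmetric] A)
    finally have "Re (cinner y y) = Re (\<Sum>i\<in>I. cinner (blinfun_apply (A i) y) (blinfun_apply (A i) x))"
      by simp
    then show ?thesis by (simp add: Re_cinner inner_commute)
  qed
  also have "\<dots> \<le> (\<Sum>i\<in>I. \<bar>norm (blinfun_apply (A i) x)\<bar> * \<bar>norm (blinfun_apply (A i) y)\<bar>)"
    by (intro sum_mono) (simp add: norm_cauchy_schwarz)
  also have "\<dots> \<le> L2_set (\<lambda>i. norm (blinfun_apply (A i) x)) I * L2_set (\<lambda>i. norm (blinfun_apply (A i) y)) I"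
    by (rule L2_set_mult_ineq)
  also have "\<dots> \<le> sqrt (M * (norm x)\<^sup>2) * sqrt (M * (norm y)\<^sup>2)"
    unfolding L2_set_def by (intro mult_mono real_sqrt_le_mono M) (simp_all add: \<open>0 \<le> M\<close> sum_nonneg)
  also have "\<dots> = M * norm x * norm y"
    using \<open>0 \<le> M\<close> by (simp add: real_sqrt_mult)
  finally have "norm y * norm y \<le> M * norm x * norm y"
    by (simp flip: power2_norm_eq_inner power2_eq_square)
  then have "norm y \<le> M * norm x"
    using \<open>0 \<le> M\<close> by (cases "y = 0") auto
  then show "norm (blinfun_apply (\<Sum>i\<in>I. cadjoint (A i) o\<^sub>L A i) x) \<le> M * norm x"
    by (simp add: y_def B_def)
qed fact

lemma columns_bounded:
  fixes A :: "'i \<Rightarrow> 'a::chilbert_space \<Rightarrow>\<^sub>L 'a"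
  assumes A: "\<And>i. i \<in> I \<Longrightarrow> A i \<in> bounded_ops"
  shows "(\<Sum>i\<in>I. (norm (blinfun_apply (A i) x))\<^sup>2)
    \<le> norm (\<Sum>i\<in>I. cadjoint (A i) o\<^sub>L A i) * (norm x)\<^sup>2"
proof -
  define B where "B = (\<Sum>i\<in>I. cadjoint (A i) o\<^sub>L A i)"
  have "(\<Sum>i\<in>I. (norm (blinfun_apply (A i) x))\<^sup>2)
      = Re (\<Sum>i\<in>I. cinner (blinfun_apply (A i) x) (blinfun_apply (A i) x))"
    by (simp add: Re_cinner power2_norm_eq_inner)
  also have "(\<Sum>i\<in>I. cinner (blinfun_apply (A i) x) (blinfun_apply (A i) x)) = cinner x (blinfun_apply B x)"
    by (simp add: B_def blinfun.sum_left cinner_sum_right cinner_cadjoint A)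
  also have "Re \<dots> \<le> norm x * norm (blinfun_apply B x)"
    by (simp add: Re_cinner norm_cauchy_schwarz)
  also have "\<dots> \<le> norm x * (norm B * norm x)"
    by (intro mult_left_mono norm_blinfun) auto
  finally show ?thesis by (simp add: B_def power2_eq_square mult_ac)
qed


section \<open>Tensor products of operators\<close>

lemma norm_sum_sq_orthogonal:
  fixes v :: "'i \<Rightarrow> 'a::complex_inner"
  assumes "finite I" and "\<And>i j. i \<in> I \<Longrightarrow> j \<in> I \<Longrightarrow> i \<noteq> j \<Longrightarrow> cinner (v i) (v j) = 0"
  shows "(norm (\<Sum>i\<in>I. v i))\<^sup>2 = (\<Sum>i\<in>I. (norm (v i))\<^sup>2)"
proof (rule norm_sum_Pythagorean[OF \<open>finite I\<close>])
  show "pairwise (\<lambda>i j. orthogonal (v i) (v j)) I"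
    using assms(2) by (simp add: pairwise_def orthogonal_def flip: Re_cinner)
qed

text \<open>
  Gram-Schmidt without normalization: the vectors \<open>f j\<close> may vanish, and then division by zero
  gives the harmless coefficient \<open>0\<close>.
\<close>

lemma orthogonal_expansion:
  fixes y :: "'j \<Rightarrow> 'a::complex_inner"
  assumes "finite J"
  obtains f :: "'j \<Rightarrow> 'a" and c :: "'j \<Rightarrow> 'j \<Rightarrow> complex"
    where "\<And>i j. i \<in> J \<Longrightarrow> j \<in> J \<Longrightarrow> i \<noteq> j \<Longrightarrow> cinner (f i) (f j) = 0"
      and "\<And>l. l \<in> J \<Longrightarrow> y l = (\<Sum>m\<in>J. c l m *\<^sub>C f m)"
proof -
  have "\<exists>f c. (\<forall>i\<in>J. \<forall>j\<in>J. i \<noteq> j \<longrightarrow> cinner (f i) (f j) = 0) \<and>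
      (\<forall>l\<in>J. y l = (\<Sum>m\<in>J. c l m *\<^sub>C f m))"
    using assms
  proof (induction J)
    case (insert a J)
    obtain f c where fc: "(\<forall>i\<in>J. \<forall>j\<in>J. i \<noteq> j \<longrightarrow> cinner (f i) (f j) = 0) \<and>
        (\<forall>l\<in>J. y l = (\<Sum>m\<in>J. c l m *\<^sub>C f m))"
      using insert.IH by (elim exE)
    have orth: "cinner (f i) (f j) = 0" if "i \<in> J" "j \<in> J" "i \<noteq> j" for i j
      using fc that by simp
    have y: "y l = (\<Sum>m\<in>J. c l m *\<^sub>C f m)" if "l \<in> J" for l
      using fc that by simp
    define d where "d m = cinner (y a) (f m) / cinner (f m) (f m)" for m
    define g where "g = y a - (\<Sum>m\<in>J. d m *\<^sub>C f m)"
    have g: "cinner g (f j) = 0" if j: "j \<in> J" for j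
    proof -
      have "(\<Sum>m\<in>J. d m * cinner (f m) (f j)) = (\<Sum>m\<in>J. if m = j then d j * cinner (f j) (f j) else 0)"
        using j orth by (intro sum.cong) auto
      also have "\<dots> = cinner (y a) (f j)"
        using j insert.hyps by (cases "f j = 0") (simp_all add: d_def cinner_self)
      finally show ?thesis
        by (simp add: g_def cinner_minus_left cinner_sum_left cinner_scaleC_left)
    qed
    then have g': "cinner (f j) g = 0" if "j \<in> J" for j
      using that cinner_commute[of "f j" g] by simp
    define f' where "f' = f(a := g)"
    define c' where "c' = (\<lambda>l m. if l = a then (if m = a then 1 else d m)
        else if m = a then 0 else c l m)"
    have f': "f' a = g" "\<And>m. m \<in> J \<Longrightarrow> f' m = f m" using insert.hyps by (auto simp: f'_def)
    have "y l = (\<Sum>m\<in>insert a J. c' l m *\<^sub>C f' m)" if l: "l \<in> insert a J" for l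
    proof (cases "l = a")
      case True
      have "(\<Sum>m\<in>J. c' l m *\<^sub>C f' m) = (\<Sum>m\<in>J. d m *\<^sub>C f m)"
        using insert.hyps True by (intro sum.cong) (auto simp: c'_def f')
      then show ?thesis using insert.hyps True by (simp add: g_def f' c'_def)
    next
      case False
      have "(\<Sum>m\<in>J. c' l m *\<^sub>C f' m) = (\<Sum>m\<in>J. c l m *\<^sub>C f m)"
        using insert.hyps False by (intro sum.cong) (auto simp: c'_def f')
      then show ?thesis using insert.hyps False l y[of l] by (simp add: f' c'_def)
    qed
    moreover have "cinner (f' i) (f' j) = 0" if "i \<in> insert a J" "j \<in> insert a J" "i \<noteq> j" for i j
      using that orth g g' by (auto simp: f')
    ultimately show ?case by blast
  qed simp
  then obtain f c where fc: "(\<forall>i\<in>J. \<forall>j\<in>J. i \<noteq> j \<longrightarrow> cinner (f i) (f j) = 0) \<and>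
      (\<forall>l\<in>J. y l = (\<Sum>m\<in>J. c l m *\<^sub>C f m))"
    by (elim exE)
  show ?thesis by (rule that[of f c]) (simp_all add: fc)
qed

text \<open>
  A linear relation whose elements satisfy \<open>\<parallel>v\<parallel> \<le> C \<parallel>u\<parallel>\<close> has a closure with the same property;
  if its domain is dense, the closure is the graph of a bounded operator.
\<close>

lemma bounded_relation_extends:
  fixes R :: "('a::real_normed_vector \<times> 'b::{real_normed_vector,complete_space}) set"
  assumes sub: "subspace R" and bound: "\<And>u v. (u, v) \<in> R \<Longrightarrow> norm v \<le> C * norm u"
    and dense: "closure (fst ` R) = UNIV"
  obtains T :: "'a \<Rightarrow>\<^sub>L 'b" where "\<And>u v. (u, v) \<in> R \<Longrightarrow> blinfun_apply T u = v"
proof -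
  have closed: "closed {p :: 'a \<times> 'b. norm (snd p) \<le> C * norm (fst p)}"
    by (intro closed_Collect_le continuous_intros)
  have "closure R \<subseteq> {p. norm (snd p) \<le> C * norm (fst p)}"
    using bound by (intro closure_minimal closed) auto
  then have cbound: "norm v \<le> C * norm u" if "(u, v) \<in> closure R" for u v
    using that by fastforce
  have csub: "subspace (closure R)"
  proof (rule subspaceI)
    show "0 \<in> closure R" using sub closure_subset[of R] subspace_0 by blast
    fix p q c assume p: "p \<in> closure R" and q: "q \<in> closure R"
    from p q obtain P Q where P: "\<And>i. P i \<in> R" "P \<longlonglongrightarrow> p" and Q: "\<And>i. Q i \<in> R" "Q \<longlonglongrightarrow> q"
      unfolding closure_sequential by metis
    show "p + q \<in> closure R"
      unfolding closure_sequential
      using P Q by (intro exI[of _ "\<lambda>i. P i + Q i"]) (auto intro!: tendsto_intros subspace_add[OF sub])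
    show "c *\<^sub>R p \<in> closure R" for c
      unfolding closure_sequential
      using P by (intro exI[of _ "\<lambda>i. c *\<^sub>R P i"]) (auto intro!: tendsto_intros subspace_scale[OF sub])
  qed
  have unique: "v = w" if "(u, v) \<in> closure R" "(u, w) \<in> closure R" for u v w
    using cbound[of "u - u" "v - w"] subspace_diff[OF csub that] by simp
  have total: "\<exists>v. (u, v) \<in> closure R" for u
  proof -
    have "u \<in> closure (fst ` R)" using dense by simp
    then obtain U where U: "\<And>i. U i \<in> fst ` R" "U \<longlonglongrightarrow> u" unfolding closure_sequential by blast
    have "\<exists>v. (U i, v) \<in> R" for i using U(1)[of i] by auto
    then obtain V where V: "\<And>i. (U i, V i) \<in> R" by metis
    have diff: "norm (V i - V j) \<le> C * norm (U i - U j)" for i j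
      using subspace_diff[OF sub V[of i] V[of j]] bound[of "U i - U j" "V i - V j"] by simp
    have "Cauchy V"
    proof (rule metric_CauchyI)
      fix e :: real assume e: "e > 0"
      obtain M where M: "\<forall>m\<ge>M. \<forall>n\<ge>M. dist (U m) (U n) < e / (\<bar>C\<bar> + 1)"
        using metric_CauchyD[OF LIMSEQ_imp_Cauchy[OF U(2)], of "e / (\<bar>C\<bar> + 1)"] e by auto
      have "dist (V m) (V n) < e" if "m \<ge> M" "n \<ge> M" for m n
      proof -
        have "dist (V m) (V n) \<le> (\<bar>C\<bar> + 1) * dist (U m) (U n)"
          using diff[of m n] mult_right_mono[of C "\<bar>C\<bar> + 1" "norm (U m - U n)"] abs_ge_self[of C]
          by (simp add: dist_norm)
        also have "\<dots> < e" using M that by (simp add: field_simps)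
        finally show ?thesis .
      qed
      then show "\<exists>M. \<forall>m\<ge>M. \<forall>n\<ge>M. dist (V m) (V n) < e" by blast
    qed
    then obtain v where "V \<longlonglongrightarrow> v" using Cauchy_convergent convergent_def by blast
    then have "(\<lambda>i. (U i, V i)) \<longlonglongrightarrow> (u, v)" using U(2) by (intro tendsto_intros)
    then show ?thesis unfolding closure_sequential
      using V by (intro exI[of _ v] exI[of _ "\<lambda>i. (U i, V i)"]) simp
  qed
  then obtain f where f: "\<And>u. (u, f u) \<in> closure R" by metis
  have "bounded_linear f"
  proof (rule bounded_linear_intro)
    show "f (x + y) = f x + f y" for x y
      using subspace_add[OF csub f[of x] f[of y]] f[of "x + y"] by (auto intro: unique)
    show "f (c *\<^sub>R x) = c *\<^sub>R f x" for c x
      using subspace_scale[OF csub f[of x], of c] f[of "c *\<^sub>R x"] by (auto intro: unique)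
    show "norm (f x) \<le> norm x * C" for x using cbound[OF f[of x]] by (simp add: mult.commute)
  qed
  then have app: "blinfun_apply (Blinfun f) = f" by (rule bounded_linear_Blinfun_apply)
  have "f u = v" if "(u, v) \<in> R" for u v
    using unique[OF f] that closure_subset[of R] by blast
  then show ?thesis using that[of "Blinfun f"] by (simp add: app)
qed

lemma bounded_linear_scaleC: "bounded_linear (\<lambda>x::'a::complex_inner. c *\<^sub>C x)"
proof (rule bounded_linear_intro)
  show "c *\<^sub>C (a *\<^sub>R x) = a *\<^sub>R (c *\<^sub>C x)" for a and x :: 'a
    by (simp add: scaleC_scaleC mult.commute flip: scaleC_of_real)
  show "norm (c *\<^sub>C x) \<le> norm x * cmod c" for x :: 'a by (simp add: norm_scaleC)
qed (rule scaleC_add_right)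

lemma norm_blinfun_sq: "(norm (blinfun_apply T z))\<^sup>2 \<le> (norm T)\<^sup>2 * (norm z)\<^sup>2"
  unfolding power_mult_distrib[symmetric] by (intro power_mono norm_blinfun) simp

lemma bounded_ops_sum_scaleC:
  "T \<in> bounded_ops \<Longrightarrow>
    blinfun_apply T (\<Sum>i\<in>I. c i *\<^sub>C x i) = (\<Sum>i\<in>I. c i *\<^sub>C blinfun_apply T (x i))"
  by (simp add: blinfun.sum_right bounded_opsD)

context
  fixes tens :: "'k::chilbert_space \<Rightarrow> 'h::chilbert_space \<Rightarrow> 'e::chilbert_space"
  assumes tensor: "hilbert_tensor tens"
begin

lemma
  shows tens_add_left: "tens (x + x') y = tens x y + tens x' y"
    and tens_add_right: "tens x (y + y') = tens x y + tens x y'"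
    and tens_scaleC_left: "tens (c *\<^sub>C x) y = c *\<^sub>C tens x y"
    and tens_scaleC_right: "tens x (c *\<^sub>C y) = c *\<^sub>C tens x y"
    and cinner_tens: "cinner (tens x y) (tens x' y') = cinner x x' * cinner y y'"
    and tens_dense: "closure (span {tens x y | x y. True}) = UNIV"
  using tensor unfolding hilbert_tensor_def by blast+

lemma tens_scaleR_left: "tens (a *\<^sub>R x) y = a *\<^sub>R tens x y"
  by (simp add: tens_scaleC_left flip: scaleC_of_real)

lemma tens_zero_left [simp]: "tens 0 y = 0"
  using tens_add_left[of 0 0 y] by simp

lemma tens_zero_right [simp]: "tens x 0 = 0"
  using tens_add_right[of x 0 0] by simp

lemma tens_sum_left: "tens (\<Sum>i\<in>I. x i) y = (\<Sum>i\<in>I. tens (x i) y)"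
  by (induction I rule: infinite_finite_induct) (simp_all add: tens_add_left)

lemma tens_sum_right: "tens x (\<Sum>i\<in>I. y i) = (\<Sum>i\<in>I. tens x (y i))"
  by (induction I rule: infinite_finite_induct) (simp_all add: tens_add_right)

lemma norm_tens: "norm (tens x y) = norm x * norm y"
proof -
  have "complex_of_real ((norm (tens x y))\<^sup>2) = complex_of_real ((norm x * norm y)\<^sup>2)"
    using cinner_tens[of x y x y]
    by (simp only: cinner_self of_real_mult[symmetric] power_mult_distrib)
  then show ?thesis by (simp only: of_real_eq_iff power2_eq_iff_nonneg norm_ge_zero mult_nonneg_nonneg)
qed

lemma tens_regroup_right:
  assumes "\<And>l. l \<in> L \<Longrightarrow> y l = (\<Sum>m\<in>J. c l m *\<^sub>C f m)"
  shows "(\<Sum>l\<in>L. tens (x l) (y l)) = (\<Sum>m\<in>J. tens (\<Sum>l\<in>L. c l m *\<^sub>C x l) (f m))"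
proof -
  have "(\<Sum>l\<in>L. tens (x l) (y l)) = (\<Sum>l\<in>L. \<Sum>m\<in>J. c l m *\<^sub>C tens (x l) (f m))"
    by (intro sum.cong) (simp_all add: assms tens_sum_right tens_scaleC_right)
  also have "\<dots> = (\<Sum>m\<in>J. \<Sum>l\<in>L. c l m *\<^sub>C tens (x l) (f m))" by (rule sum.swap)
  finally show ?thesis by (simp add: tens_sum_left tens_scaleC_left)
qed

lemma tens_regroup_left:
  assumes "\<And>l. l \<in> L \<Longrightarrow> x l = (\<Sum>m\<in>J. c l m *\<^sub>C f m)"
  shows "(\<Sum>l\<in>L. tens (x l) (y l)) = (\<Sum>m\<in>J. tens (f m) (\<Sum>l\<in>L. c l m *\<^sub>C y l))"
proof -
  have "(\<Sum>l\<in>L. tens (x l) (y l)) = (\<Sum>l\<in>L. \<Sum>m\<in>J. c l m *\<^sub>C tens (f m) (y l))"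
    by (intro sum.cong) (simp_all add: assms tens_sum_left tens_scaleC_left)
  also have "\<dots> = (\<Sum>m\<in>J. \<Sum>l\<in>L. c l m *\<^sub>C tens (f m) (y l))" by (rule sum.swap)
  finally show ?thesis by (simp add: tens_sum_right tens_scaleC_right)
qed

lemma norm_sum_tens_orthogonal_right:
  assumes "finite J" and "\<And>i j. i \<in> J \<Longrightarrow> j \<in> J \<Longrightarrow> i \<noteq> j \<Longrightarrow> cinner (f i) (f j) = 0"
  shows "(norm (\<Sum>m\<in>J. tens (x m) (f m)))\<^sup>2 = (\<Sum>m\<in>J. (norm (x m))\<^sup>2 * (norm (f m))\<^sup>2)"
  using norm_sum_sq_orthogonal[of J "\<lambda>m. tens (x m) (f m)"] assms
  by (simp add: cinner_tens norm_tens power_mult_distrib)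

lemma norm_sum_tens_orthogonal_left:
  assumes "finite J" and "\<And>i j. i \<in> J \<Longrightarrow> j \<in> J \<Longrightarrow> i \<noteq> j \<Longrightarrow> cinner (f i) (f j) = 0"
  shows "(norm (\<Sum>m\<in>J. tens (f m) (y m)))\<^sup>2 = (\<Sum>m\<in>J. (norm (f m))\<^sup>2 * (norm (y m))\<^sup>2)"
  using norm_sum_sq_orthogonal[of J "\<lambda>m. tens (f m) (y m)"] assms
  by (simp add: cinner_tens norm_tens power_mult_distrib)

text \<open>
  Ampliation preserves column bounds: after writing the second tensor factors in an orthogonal
  family, the claim is the bound for \<open>A\<close> summed over that family.
\<close>

lemma tens_column_bound:
  fixes A :: "'i \<Rightarrow> 'k \<Rightarrow>\<^sub>L 'k"
  assumes A: "\<And>i. i \<in> I \<Longrightarrow> A i \<in> bounded_ops"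
    and col: "\<And>x. (\<Sum>i\<in>I. (norm (blinfun_apply (A i) x))\<^sup>2) \<le> a * (norm x)\<^sup>2"
    and "finite L"
  shows "(\<Sum>i\<in>I. (norm (\<Sum>l\<in>L. tens (blinfun_apply (A i) (x l)) (y l)))\<^sup>2)
    \<le> a * (norm (\<Sum>l\<in>L. tens (x l) (y l)))\<^sup>2"
proof -
  obtain f c where orth: "\<And>i j. i \<in> L \<Longrightarrow> j \<in> L \<Longrightarrow> i \<noteq> j \<Longrightarrow> cinner (f i) (f j) = 0"
    and y: "\<And>l. l \<in> L \<Longrightarrow> y l = (\<Sum>m\<in>L. c l m *\<^sub>C f m)"
    using orthogonal_expansion[OF \<open>finite L\<close>, of y] by blast
  define z where "z m = (\<Sum>l\<in>L. c l m *\<^sub>C x l)" for m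
  have Az: "(\<Sum>l\<in>L. tens (blinfun_apply (A i) (x l)) (y l))
      = (\<Sum>m\<in>L. tens (blinfun_apply (A i) (z m)) (f m))" if "i \<in> I" for i
    unfolding z_def bounded_ops_sum_scaleC[OF A[OF that]] by (rule tens_regroup_right[OF y])
  have "(\<Sum>i\<in>I. (norm (\<Sum>l\<in>L. tens (blinfun_apply (A i) (x l)) (y l)))\<^sup>2)
      = (\<Sum>i\<in>I. \<Sum>m\<in>L. (norm (blinfun_apply (A i) (z m)))\<^sup>2 * (norm (f m))\<^sup>2)"
    using norm_sum_tens_orthogonal_right[OF \<open>finite L\<close> orth] by (intro sum.cong) (simp_all add: Az)
  also have "\<dots> = (\<Sum>m\<in>L. (\<Sum>i\<in>I. (norm (blinfun_apply (A i) (z m)))\<^sup>2) * (norm (f m))\<^sup>2)"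
    by (subst sum.swap) (simp add: sum_distrib_right)
  also have "\<dots> \<le> (\<Sum>m\<in>L. (a * (norm (z m))\<^sup>2) * (norm (f m))\<^sup>2)"
    by (intro sum_mono mult_right_mono col) simp
  also have "\<dots> = a * (norm (\<Sum>m\<in>L. tens (z m) (f m)))\<^sup>2"
    using norm_sum_tens_orthogonal_right[OF \<open>finite L\<close> orth, where x = z]
    by (simp add: sum_distrib_left mult.assoc)
  also have "(\<Sum>m\<in>L. tens (z m) (f m)) = (\<Sum>l\<in>L. tens (x l) (y l))"
    unfolding z_def by (rule tens_regroup_right[OF y, symmetric])
  finally show ?thesis .
qed

text \<open>
  Row bounds are preserved likewise, with the first tensor factors of all entries of the row
  written in one common orthogonal family.
\<close>

lemma tens_row_bound:
  fixes X :: "'i \<Rightarrow> 'h \<Rightarrow>\<^sub>L 'h"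
  assumes X: "\<And>i. i \<in> I \<Longrightarrow> X i \<in> bounded_ops"
    and row: "\<And>y. (norm (\<Sum>i\<in>I. blinfun_apply (X i) (y i)))\<^sup>2 \<le> b * (\<Sum>i\<in>I. (norm (y i))\<^sup>2)"
    and fin: "finite I" "finite L"
  shows "(norm (\<Sum>i\<in>I. \<Sum>l\<in>L. tens (x i l) (blinfun_apply (X i) (y i l))))\<^sup>2
    \<le> b * (\<Sum>i\<in>I. (norm (\<Sum>l\<in>L. tens (x i l) (y i l)))\<^sup>2)"
proof -
  define J where "J = I \<times> L"
  have J: "finite J" using fin by (simp add: J_def)
  obtain f c where orth: "\<And>i j. i \<in> J \<Longrightarrow> j \<in> J \<Longrightarrow> i \<noteq> j \<Longrightarrow> cinner (f i) (f j) = 0"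
    and exp: "\<And>l. l \<in> J \<Longrightarrow> (\<lambda>(i, l). x i l) l = (\<Sum>m\<in>J. c l m *\<^sub>C f m)"
    using orthogonal_expansion[OF J, of "\<lambda>(i, l). x i l"] by blast
  have x: "x i l = (\<Sum>m\<in>J. c (i, l) m *\<^sub>C f m)" if "i \<in> I" "l \<in> L" for i l
    using exp[of "(i, l)"] that by (simp add: J_def)
  define z where "z i m = (\<Sum>l\<in>L. c (i, l) m *\<^sub>C y i l)" for i m
  have Xz: "(\<Sum>l\<in>L. tens (x i l) (blinfun_apply (X i) (y i l)))
      = (\<Sum>m\<in>J. tens (f m) (blinfun_apply (X i) (z i m)))" if "i \<in> I" for i
    unfolding z_def bounded_ops_sum_scaleC[OF X[OF that]] using x[OF that] by (rule tens_regroup_left)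
  have yz: "(\<Sum>l\<in>L. tens (x i l) (y i l)) = (\<Sum>m\<in>J. tens (f m) (z i m))" if "i \<in> I" for i
    unfolding z_def using x[OF that] by (rule tens_regroup_left)
  have "(\<Sum>i\<in>I. \<Sum>l\<in>L. tens (x i l) (blinfun_apply (X i) (y i l)))
      = (\<Sum>i\<in>I. \<Sum>m\<in>J. tens (f m) (blinfun_apply (X i) (z i m)))"
    by (intro sum.cong Xz) auto
  also have "\<dots> = (\<Sum>m\<in>J. tens (f m) (\<Sum>i\<in>I. blinfun_apply (X i) (z i m)))"
    by (subst sum.swap) (simp add: tens_sum_right)
  finally have "(norm (\<Sum>i\<in>I. \<Sum>l\<in>L. tens (x i l) (blinfun_apply (X i) (y i l))))\<^sup>2
      = (\<Sum>m\<in>J. (norm (f m))\<^sup>2 * (norm (\<Sum>i\<in>I. blinfun_apply (X i) (z i m)))\<^sup>2)"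
    by (simp add: norm_sum_tens_orthogonal_left[OF J orth])
  also have "\<dots> \<le> (\<Sum>m\<in>J. (norm (f m))\<^sup>2 * (b * (\<Sum>i\<in>I. (norm (z i m))\<^sup>2)))"
    by (intro sum_mono mult_left_mono row) simp
  also have "\<dots> = b * (\<Sum>i\<in>I. \<Sum>m\<in>J. (norm (f m))\<^sup>2 * (norm (z i m))\<^sup>2)"
    by (subst sum.swap) (simp add: sum_distrib_left mult_ac)
  also have "\<dots> = b * (\<Sum>i\<in>I. (norm (\<Sum>l\<in>L. tens (x i l) (y i l)))\<^sup>2)"
    by (simp add: yz norm_sum_tens_orthogonal_left[OF J orth])
  finally show ?thesis .
qed

lemma tens_row_column_bound:
  fixes A :: "'i \<Rightarrow> 'k \<Rightarrow>\<^sub>L 'k" and X :: "'i \<Rightarrow> 'h \<Rightarrow>\<^sub>L 'h"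
  assumes A: "\<And>i. i \<in> I \<Longrightarrow> A i \<in> bounded_ops" and X: "\<And>i. i \<in> I \<Longrightarrow> X i \<in> bounded_ops"
    and col: "\<And>x. (\<Sum>i\<in>I. (norm (blinfun_apply (A i) x))\<^sup>2) \<le> a * (norm x)\<^sup>2"
    and row: "\<And>y. (norm (\<Sum>i\<in>I. blinfun_apply (X i) (y i)))\<^sup>2 \<le> b * (\<Sum>i\<in>I. (norm (y i))\<^sup>2)"
    and "0 \<le> b" "finite I" "finite L"
  shows "(norm (\<Sum>i\<in>I. \<Sum>l\<in>L. tens (blinfun_apply (A i) (x l)) (blinfun_apply (X i) (y l))))\<^sup>2
    \<le> a * b * (norm (\<Sum>l\<in>L. tens (x l) (y l)))\<^sup>2"
proof -
  have "(norm (\<Sum>i\<in>I. \<Sum>l\<in>L. tens (blinfun_apply (A i) (x l)) (blinfun_apply (X i) (y l))))\<^sup>2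
      \<le> b * (\<Sum>i\<in>I. (norm (\<Sum>l\<in>L. tens (blinfun_apply (A i) (x l)) (y l)))\<^sup>2)"
    using X row \<open>finite I\<close> \<open>finite L\<close> by (rule tens_row_bound)
  also have "\<dots> \<le> b * (a * (norm (\<Sum>l\<in>L. tens (x l) (y l)))\<^sup>2)"
    using A col \<open>finite L\<close> by (intro mult_left_mono \<open>0 \<le> b\<close> tens_column_bound)
  finally show ?thesis by (simp add: mult_ac)
qed

lemma span_tens_pairs:
  assumes "p \<in> span {(tens x y, tens (blinfun_apply A x) (blinfun_apply X y)) | x y. True}"
  obtains N :: nat and x y where "fst p = (\<Sum>l<N. tens (x l) (y l))"
    and "snd p = (\<Sum>l<N. tens (blinfun_apply A (x l)) (blinfun_apply X (y l)))"
proof -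
  have "\<exists>N x y. fst p = (\<Sum>l<N::nat. tens (x l) (y l)) \<and>
      snd p = (\<Sum>l<N. tens (blinfun_apply A (x l)) (blinfun_apply X (y l)))"
    using assms
  proof (induction rule: span_induct_alt)
    case base
    show ?case by (rule exI[of _ 0]) simp
  next
    case (step c p q)
    from step.IH obtain N x y where
      q: "fst q = (\<Sum>l<N::nat. tens (x l) (y l))"
        "snd q = (\<Sum>l<N. tens (blinfun_apply A (x l)) (blinfun_apply X (y l)))" by (elim exE conjE)
    from step.hyps obtain x0 y0 where
      p: "p = (tens x0 y0, tens (blinfun_apply A x0) (blinfun_apply X y0))" by auto
    show ?case
      by (rule exI[of _ "Suc N"], rule exI[of _ "x(N := c *\<^sub>R x0)"], rule exI[of _ "y(N := y0)"])
         (simp add: p q tens_scaleR_left blinfun.scaleR_right)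
  qed
  then show ?thesis by (elim exE conjE) (rule that)
qed

lemma span_tens_pairs_fst:
  "fst ` span {(tens x y, tens (blinfun_apply A x) (blinfun_apply X y)) | x y. True}
    = span {tens x y | x y. True}"
proof -
  have "fst ` {(tens x y, tens (blinfun_apply A x) (blinfun_apply X y)) | x y. True}
      = {tens x y | x y. True}" by (auto simp: image_iff) blast+
  then show ?thesis by (simp only: linear_span_image[OF linear_fst, symmetric])
qed

lemma bounded_linear_eq_if_eq_on_tens:
  assumes f: "bounded_linear f" and g: "bounded_linear g"
    and eq: "\<And>x y. f (tens x y) = g (tens x y)"
  shows "f u = g u"
proof -
  have "closed {u. f u = g u}"
    by (intro closed_Collect_eq linear_continuous_on f g)
  moreover have "f u = g u" if "u \<in> span {tens x y | x y. True}" for u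
    by (rule linear_eq_on_span[OF bounded_linear.linear[OF f] bounded_linear.linear[OF g] _ that])
       (auto simp: eq)
  ultimately have "closure (span {tens x y | x y. True}) \<subseteq> {u. f u = g u}"
    by (intro closure_minimal) auto
  then show ?thesis using tens_dense by blast
qed

text \<open>
  The operator is the extension of the linear relation spanned by the pairs
  \<open>(x \<otimes> y, A x \<otimes> X y)\<close>; the row-column bound for a single entry says that this relation is bounded, and
  hence single-valued.
\<close>

lemma op_tensor_exists:
  assumes A: "A \<in> bounded_ops" and X: "X \<in> bounded_ops"
  shows "\<exists>!T. T \<in> bounded_ops \<and>
    (\<forall>x y. blinfun_apply T (tens x y) = tens (blinfun_apply A x) (blinfun_apply X y))"
proof -
  define R where "R = span {(tens x y, tens (blinfun_apply A x) (blinfun_apply X y)) | x y. True}"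
  have bound: "norm v \<le> (norm A * norm X) * norm u" if uv: "(u, v) \<in> R" for u v
  proof -
    obtain N x y where xy: "u = (\<Sum>l<N::nat. tens (x l) (y l))"
        "v = (\<Sum>l<N. tens (blinfun_apply A (x l)) (blinfun_apply X (y l)))"
      by (rule span_tens_pairs[OF uv[unfolded R_def]]) simp
    have "(norm v)\<^sup>2 \<le> (norm A)\<^sup>2 * (norm X)\<^sup>2 * (norm u)\<^sup>2"
      using tens_row_column_bound[of "{()}" "\<lambda>_. A" "\<lambda>_. X" "(norm A)\<^sup>2" "(norm X)\<^sup>2" "{..<N}" x y]
        A X norm_blinfun_sq[of A] norm_blinfun_sq[of X] by (simp add: xy)
    then have "(norm v)\<^sup>2 \<le> ((norm A * norm X) * norm u)\<^sup>2" by (simp add: power_mult_distrib)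
    then show ?thesis by (rule power2_le_imp_le) simp
  qed
  have "subspace R" by (simp add: R_def)
  moreover have "closure (fst ` R) = UNIV" unfolding R_def span_tens_pairs_fst by (rule tens_dense)
  ultimately obtain T where T: "\<And>u v. (u, v) \<in> R \<Longrightarrow> blinfun_apply T u = v"
    using bounded_relation_extends[OF _ bound] by metis
  have T': "blinfun_apply T (tens x y) = tens (blinfun_apply A x) (blinfun_apply X y)" for x y
    by (rule T) (auto simp: R_def intro: span_base)
  have "blinfun_apply T (c *\<^sub>C u) = c *\<^sub>C blinfun_apply T u" for c u
  proof (rule bounded_linear_eq_if_eq_on_tens[where f = "\<lambda>u. blinfun_apply T (c *\<^sub>C u)"
        and g = "\<lambda>u. c *\<^sub>C blinfun_apply T u"])
    show "bounded_linear (\<lambda>u. blinfun_apply T (c *\<^sub>C u))"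
      by (rule bounded_linear_compose[OF blinfun.bounded_linear_right bounded_linear_scaleC])
    show "bounded_linear (\<lambda>u. c *\<^sub>C blinfun_apply T u)"
      by (rule bounded_linear_compose[OF bounded_linear_scaleC blinfun.bounded_linear_right])
    show "blinfun_apply T (c *\<^sub>C tens x y) = c *\<^sub>C blinfun_apply T (tens x y)" for x y
      by (simp add: T' bounded_opsD[OF A] flip: tens_scaleC_left)
  qed
  then have "T \<in> bounded_ops" by (simp add: bounded_ops_def)
  moreover have "T1 = T2"
    if "\<And>x y. blinfun_apply T1 (tens x y) = blinfun_apply T2 (tens x y)" for T1 T2 :: "'e \<Rightarrow>\<^sub>L 'e"
    by (rule blinfun_eqI, rule bounded_linear_eq_if_eq_on_tens[where f = "blinfun_apply T1" and g = "blinfun_apply T2"])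
       (simp_all add: that blinfun.bounded_linear_right)
  ultimately show ?thesis using T' by (intro ex1I[of _ T]) auto
qed

lemma op_tensor_apply:
  assumes "A \<in> bounded_ops" "X \<in> bounded_ops"
  shows "blinfun_apply (op_tensor tens A X) (tens x y) = tens (blinfun_apply A x) (blinfun_apply X y)"
  using theI'[OF op_tensor_exists[OF assms]] unfolding op_tensor_def by blast

text \<open>
  The sum of the \<open>A i \<otimes> X i\<close> is the product of the row of the \<open>1 \<otimes> X i\<close> with the column of the
  \<open>A i \<otimes> 1\<close>, so its norm is at most the product of the norms of the row and of the column.
\<close>

lemma norm_sum_op_tensor_le:
  fixes A :: "'i \<Rightarrow> 'k \<Rightarrow>\<^sub>L 'k" and X :: "'i \<Rightarrow> 'h \<Rightarrow>\<^sub>L 'h"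
  assumes A: "\<And>i. i \<in> I \<Longrightarrow> A i \<in> bounded_ops" and X: "\<And>i. i \<in> I \<Longrightarrow> X i \<in> bounded_ops"
    and col: "\<And>x. (\<Sum>i\<in>I. (norm (blinfun_apply (A i) x))\<^sup>2) \<le> a * (norm x)\<^sup>2"
    and row: "\<And>y. (norm (\<Sum>i\<in>I. blinfun_apply (X i) (y i)))\<^sup>2 \<le> b * (\<Sum>i\<in>I. (norm (y i))\<^sup>2)"
    and "0 \<le> a" "0 \<le> b" "finite I"
  shows "norm (\<Sum>i\<in>I. op_tensor tens (A i) (X i)) \<le> sqrt (a * b)"
proof (rule norm_blinfun_bound)
  define T where "T = (\<Sum>i\<in>I. op_tensor tens (A i) (X i))"
  have "(norm (blinfun_apply T u))\<^sup>2 \<le> a * b * (norm u)\<^sup>2"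
    if u: "u \<in> span {tens x y | x y. True}" for u
  proof -
    obtain N x y where xy: "u = (\<Sum>l<N::nat. tens (x l) (y l))"
    proof -
      obtain p where p: "u = fst p" 
          "p \<in> span {(tens x y, tens (blinfun_apply id_blinfun x) (blinfun_apply id_blinfun y)) | x y. True}"
        using u unfolding span_tens_pairs_fst[of id_blinfun id_blinfun, symmetric] by (rule imageE)
      show ?thesis by (rule span_tens_pairs[OF p(2)]) (rule that, simp add: p(1))
    qed
    have "blinfun_apply T u
        = (\<Sum>l<N. \<Sum>i\<in>I. tens (blinfun_apply (A i) (x l)) (blinfun_apply (X i) (y l)))"
      by (simp add: T_def xy blinfun.sum_left blinfun.sum_right op_tensor_apply A X cong: sum.cong)
    also have "\<dots> = (\<Sum>i\<in>I. \<Sum>l<N. tens (blinfun_apply (A i) (x l)) (blinfun_apply (X i) (y l)))"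
      by (rule sum.swap)
    finally have "blinfun_apply T u
        = (\<Sum>i\<in>I. \<Sum>l<N. tens (blinfun_apply (A i) (x l)) (blinfun_apply (X i) (y l)))" .
    then show ?thesis
      using tens_row_column_bound[OF A X col row \<open>0 \<le> b\<close> \<open>finite I\<close>, of "{..<N}" x y] by (simp add: xy)
  qed
  moreover have "closed {u. (norm (blinfun_apply T u))\<^sup>2 \<le> a * b * (norm u)\<^sup>2}"
    by (intro closed_Collect_le continuous_intros)
  ultimately have "closure (span {tens x y | x y. True}) \<subseteq> {u. (norm (blinfun_apply T u))\<^sup>2 \<le> a * b * (norm u)\<^sup>2}"
    by (intro closure_minimal) auto
  then have "(norm (blinfun_apply T u))\<^sup>2 \<le> a * b * (norm u)\<^sup>2" for u using tens_dense by blast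
  then have "sqrt ((norm (blinfun_apply T u))\<^sup>2) \<le> sqrt (a * b * (norm u)\<^sup>2)" for u
    by (rule real_sqrt_le_mono)
  then show "norm (blinfun_apply (\<Sum>i\<in>I. op_tensor tens (A i) (X i)) u) \<le> sqrt (a * b) * norm u" for u
    by (simp add: T_def real_sqrt_mult)
qed (simp add: \<open>0 \<le> a\<close> \<open>0 \<le> b\<close>)

end


section \<open>Row contractions\<close>

text \<open>
  The squared norm of the row operator \<open>(X i)\<^sub>i\<close> is at most \<open>b\<close>.  Unlike \<open>\<parallel>\<Sum>\<^sub>i X i (X i)\<^sup>*\<parallel> \<le> b\<close> this makes no
  reference to adjoints, so it visibly passes to limits and to products of rows.
\<close>

definition row_bounded :: "'i set \<Rightarrow> ('i \<Rightarrow> 'h::real_normed_vector \<Rightarrow>\<^sub>L 'h) \<Rightarrow> real \<Rightarrow> bool" where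
  "row_bounded I X b \<longleftrightarrow>
     (\<forall>y. (norm (\<Sum>i\<in>I. blinfun_apply (X i) (y i)))\<^sup>2 \<le> b * (\<Sum>i\<in>I. (norm (y i))\<^sup>2))"

lemma row_boundedD:
  "row_bounded I X b \<Longrightarrow> (norm (\<Sum>i\<in>I. blinfun_apply (X i) (y i)))\<^sup>2 \<le> b * (\<Sum>i\<in>I. (norm (y i))\<^sup>2)"
  by (simp add: row_bounded_def)

lemma row_bounded_scaleR:
  assumes "row_bounded I X b"
  shows "row_bounded I (\<lambda>i. r *\<^sub>R X i) (r\<^sup>2 * b)"
  unfolding row_bounded_def
proof
  fix y
  have "(norm (\<Sum>i\<in>I. blinfun_apply (r *\<^sub>R X i) (y i)))\<^sup>2
      = r\<^sup>2 * (norm (\<Sum>i\<in>I. blinfun_apply (X i) (y i)))\<^sup>2"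
    by (simp add: blinfun.scaleR_left power_mult_distrib flip: scaleR_sum_right)
  also have "\<dots> \<le> r\<^sup>2 * (b * (\<Sum>i\<in>I. (norm (y i))\<^sup>2))"
    by (intro mult_left_mono row_boundedD assms) simp
  finally show "(norm (\<Sum>i\<in>I. blinfun_apply (r *\<^sub>R X i) (y i)))\<^sup>2 \<le> r\<^sup>2 * b * (\<Sum>i\<in>I. (norm (y i))\<^sup>2)"
    by (simp add: mult.assoc)
qed

lemma row_bounded_product:
  assumes X: "row_bounded I X b" and Y: "row_bounded J Y c" and "0 \<le> b"
  shows "row_bounded (I \<times> J) (\<lambda>(i, j). X i o\<^sub>L Y j) (b * c)"
  unfolding row_bounded_def
proof
  fix y
  have "(\<Sum>p\<in>I \<times> J. blinfun_apply ((\<lambda>(i, j). X i o\<^sub>L Y j) p) (y p))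
      = (\<Sum>i\<in>I. blinfun_apply (X i) (\<Sum>j\<in>J. blinfun_apply (Y j) (y (i, j))))"
    by (simp add: sum.cartesian_product' blinfun.sum_right case_prod_unfold)
  then have "(norm (\<Sum>p\<in>I \<times> J. blinfun_apply ((\<lambda>(i, j). X i o\<^sub>L Y j) p) (y p)))\<^sup>2
      \<le> b * (\<Sum>i\<in>I. (norm (\<Sum>j\<in>J. blinfun_apply (Y j) (y (i, j))))\<^sup>2)"
    using row_boundedD[OF X] by simp
  also have "\<dots> \<le> b * (\<Sum>i\<in>I. c * (\<Sum>j\<in>J. (norm (y (i, j)))\<^sup>2))"
    by (intro mult_left_mono sum_mono row_boundedD[OF Y] \<open>0 \<le> b\<close>)
  also have "\<dots> = b * c * (\<Sum>p\<in>I \<times> J. (norm (y p))\<^sup>2)"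
    by (simp add: sum.cartesian_product' sum_distrib_left mult.assoc)
  finally show "(norm (\<Sum>p\<in>I \<times> J. blinfun_apply ((\<lambda>(i, j). X i o\<^sub>L Y j) p) (y p)))\<^sup>2
      \<le> b * c * (\<Sum>p\<in>I \<times> J. (norm (y p))\<^sup>2)" .
qed

lemma row_bounded_reindex:
  assumes "inj_on h I" and "row_bounded I Y b" and "\<And>i. i \<in> I \<Longrightarrow> X (h i) = Y i"
  shows "row_bounded (h ` I) X b"
  unfolding row_bounded_def
proof
  fix y
  show "(norm (\<Sum>i\<in>h ` I. blinfun_apply (X i) (y i)))\<^sup>2 \<le> b * (\<Sum>i\<in>h ` I. (norm (y i))\<^sup>2)"
    using row_boundedD[OF assms(2), of "\<lambda>i. y (h i)"]
    by (simp add: sum.reindex[OF assms(1)] assms(3) cong: sum.cong)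
qed

lemma row_bounded_singleton_id: "row_bounded {a} (\<lambda>_. id_blinfun) 1"
  by (simp add: row_bounded_def)

text \<open>
  With \<open>v = \<Sum>\<^sub>i X i (y i)\<close> one has \<open>\<parallel>v\<parallel>\<^sup>2 = \<Sum>\<^sub>i \<langle>y i, (X i)\<^sup>* v\<rangle>\<close>, and the column of the adjoints is bounded by
  \<open>columns_bounded\<close>.
\<close>

lemma row_bounded_norm:
  fixes X :: "'i \<Rightarrow> 'h::chilbert_space \<Rightarrow>\<^sub>L 'h"
  assumes X: "\<And>i. i \<in> I \<Longrightarrow> X i \<in> bounded_ops"
  shows "row_bounded I X (norm (\<Sum>i\<in>I. X i o\<^sub>L cadjoint (X i)))"
  unfolding row_bounded_def
proof
  fix y
  define c where "c = norm (\<Sum>i\<in>I. X i o\<^sub>L cadjoint (X i))"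
  define v where "v = (\<Sum>i\<in>I. blinfun_apply (X i) (y i))"
  have "cinner v v = (\<Sum>i\<in>I. cinner (y i) (blinfun_apply (cadjoint (X i)) v))"
    by (subst v_def) (simp add: cinner_sum_left cinner_cadjoint X)
  then have "Re (cinner v v) = Re (\<Sum>i\<in>I. cinner (y i) (blinfun_apply (cadjoint (X i)) v))" by simp
  then have "(norm v)\<^sup>2 = (\<Sum>i\<in>I. inner (y i) (blinfun_apply (cadjoint (X i)) v))"
    by (simp add: Re_cinner power2_norm_eq_inner)
  also have "\<dots> \<le> (\<Sum>i\<in>I. \<bar>norm (y i)\<bar> * \<bar>norm (blinfun_apply (cadjoint (X i)) v)\<bar>)"
    by (intro sum_mono) (simp add: norm_cauchy_schwarz)
  also have "\<dots> \<le> L2_set (\<lambda>i. norm (y i)) I * L2_set (\<lambda>i. norm (blinfun_apply (cadjoint (X i)) v)) I"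
    by (rule L2_set_mult_ineq)
  also have "\<dots> \<le> L2_set (\<lambda>i. norm (y i)) I * sqrt (c * (norm v)\<^sup>2)"
  proof (intro mult_left_mono)
    have "(\<Sum>i\<in>I. cadjoint (cadjoint (X i)) o\<^sub>L cadjoint (X i)) = (\<Sum>i\<in>I. X i o\<^sub>L cadjoint (X i))"
      by (intro sum.cong refl) (simp add: cadjoint_cadjoint X)
    then show "L2_set (\<lambda>i. norm (blinfun_apply (cadjoint (X i)) v)) I \<le> sqrt (c * (norm v)\<^sup>2)"
      using columns_bounded[of I "\<lambda>i. cadjoint (X i)" v] X
      by (simp add: L2_set_def c_def cadjoint_bounded_ops)
  qed simp
  also have "\<dots> = (L2_set (\<lambda>i. norm (y i)) I * sqrt c) * norm v"
    by (simp add: real_sqrt_mult)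
  finally have "norm v * norm v \<le> (L2_set (\<lambda>i. norm (y i)) I * sqrt c) * norm v"
    by (simp add: power2_eq_square)
  then have "norm v \<le> L2_set (\<lambda>i. norm (y i)) I * sqrt c"
    by (cases "v = 0") (auto simp: c_def)
  then have "(norm v)\<^sup>2 \<le> (L2_set (\<lambda>i. norm (y i)) I * sqrt c)\<^sup>2"
    by (intro power_mono) auto
  also have "\<dots> = c * (\<Sum>i\<in>I. (norm (y i))\<^sup>2)"
    by (simp add: power_mult_distrib L2_set_def sum_nonneg c_def mult.commute)
  finally show "(norm (\<Sum>i\<in>I. blinfun_apply (X i) (y i)))\<^sup>2
      \<le> norm (\<Sum>i\<in>I. X i o\<^sub>L cadjoint (X i)) * (\<Sum>i\<in>I. (norm (y i))\<^sup>2)"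
    by (simp add: v_def c_def)
qed

lemma bounded_ops_zero: "0 \<in> bounded_ops"
  by (simp add: bounded_ops_def)

lemma bounded_ops_scaleR: "T \<in> bounded_ops \<Longrightarrow> a *\<^sub>R T \<in> bounded_ops"
  by (simp add: bounded_ops_def blinfun.scaleR_left scaleC_scaleC mult.commute flip: scaleC_of_real)

lemma bounded_ops_compose: "S \<in> bounded_ops \<Longrightarrow> T \<in> bounded_ops \<Longrightarrow> S o\<^sub>L T \<in> bounded_ops"
  by (simp add: bounded_ops_def)

lemma bounded_ops_id: "id_blinfun \<in> bounded_ops"
  by (simp add: bounded_ops_def)

lemma polyball_bounded_ops: "X \<in> polyball k n \<Longrightarrow> X i j \<in> bounded_ops"
proof -
  assume "X \<in> polyball k n"
  then have "if i < k \<and> j < n i then X i j \<in> bounded_ops else X i j = 0"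
    unfolding polyball_def commuting_tuples_def by blast
  then show ?thesis by (auto simp: bounded_ops_zero split: if_splits)
qed

lemma polyball_row_bounded:
  fixes X :: "nat \<Rightarrow> nat \<Rightarrow> 'h::chilbert_space \<Rightarrow>\<^sub>L 'h"
  assumes "X \<in> polyball k n" "i < k"
  obtains c where "0 \<le> c" "c < 1" "row_bounded {..<n i} (X i) c"
proof
  show "row_bounded {..<n i} (X i) (norm (\<Sum>j<n i. X i j o\<^sub>L cadjoint (X i j)))"
    by (rule row_bounded_norm) (rule polyball_bounded_ops[OF assms(1)])
qed (use assms in \<open>auto simp: polyball_def\<close>)

text \<open>
  Complex linearity of the entries and the row bound are pointwise conditions, closed in the
  topology of entrywise convergence.
\<close>

lemma closure_polyball:
  fixes X :: "nat \<Rightarrow> nat \<Rightarrow> 'h::chilbert_space \<Rightarrow>\<^sub>L 'h"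
  assumes "X \<in> closure (polyball k n)"
  shows "X i j \<in> bounded_ops" and "i < k \<Longrightarrow> row_bounded {..<n i} (X i) 1"
proof -
  have entry: "continuous_on UNIV (\<lambda>X :: nat \<Rightarrow> nat \<Rightarrow> 'h \<Rightarrow>\<^sub>L 'h. X i j)" for i j
    by (rule continuous_on_product_then_coordinatewise[OF continuous_on_product_coordinates])
  note continuous = continuous_intros blinfun.continuous_on[OF entry continuous_on_const] entry
  have "polyball k n \<subseteq> {X. \<forall>i j c x. blinfun_apply (X i j) (c *\<^sub>C x :: 'h) = c *\<^sub>C blinfun_apply (X i j) x}"
    using polyball_bounded_ops by (fastforce simp: bounded_ops_def)
  moreover have "closed {X :: nat \<Rightarrow> nat \<Rightarrow> 'h \<Rightarrow>\<^sub>L 'h. \<forall>i j c x. blinfun_apply (X i j) (c *\<^sub>C x :: 'h) = c *\<^sub>C blinfun_apply (X i j) x}"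
    by (intro closed_Collect_all closed_Collect_eq continuous
        continuous_on_compose2[OF linear_continuous_on[OF bounded_linear_scaleC] _ subset_UNIV])
  ultimately have "closure (polyball k n)
      \<subseteq> {X. \<forall>i j c x. blinfun_apply (X i j) (c *\<^sub>C x :: 'h) = c *\<^sub>C blinfun_apply (X i j) x}"
    by (rule closure_minimal)
  then show "X i j \<in> bounded_ops" using assms by (auto simp: bounded_ops_def)
  assume i: "i < k"
  have "row_bounded {..<n i} (X i) 1" if X: "X \<in> polyball k n" for X :: "nat \<Rightarrow> nat \<Rightarrow> 'h \<Rightarrow>\<^sub>L 'h"
  proof -
    obtain c where "c < 1" and c: "row_bounded {..<n i} (X i) c"
      using polyball_row_bounded[OF X i] by blast
    show ?thesis
      unfolding row_bounded_def
    proof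
      fix y :: "nat \<Rightarrow> 'h"
      have "c * (\<Sum>j<n i. (norm (y j))\<^sup>2) \<le> 1 * (\<Sum>j<n i. (norm (y j))\<^sup>2)"
        using \<open>c < 1\<close> by (intro mult_right_mono sum_nonneg) auto
      then show "(norm (\<Sum>j<n i. blinfun_apply (X i j) (y j)))\<^sup>2 \<le> 1 * (\<Sum>j<n i. (norm (y j))\<^sup>2)"
        using row_boundedD[OF c, of y] by linarith
    qed
  qed
  then have "polyball k n \<subseteq> {X :: nat \<Rightarrow> nat \<Rightarrow> 'h \<Rightarrow>\<^sub>L 'h. row_bounded {..<n i} (X i) 1}" by blast
  moreover have "closed {X :: nat \<Rightarrow> nat \<Rightarrow> 'h \<Rightarrow>\<^sub>L 'h. row_bounded {..<n i} (X i) 1}"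
    unfolding row_bounded_def by (intro closed_Collect_all closed_Collect_le continuous)
  ultimately have "closure (polyball k n) \<subseteq> {X :: nat \<Rightarrow> nat \<Rightarrow> 'h \<Rightarrow>\<^sub>L 'h. row_bounded {..<n i} (X i) 1}"
    by (rule closure_minimal)
  then show "row_bounded {..<n i} (X i) 1" using assms by blast
qed


section \<open>Rows of words\<close>

definition words :: "nat \<Rightarrow> nat \<Rightarrow> nat list set" where
  "words m p = {w \<in> lists {..<m}. length w = p}"

lemma words_0: "words m 0 = {[]}"
  by (auto simp: words_def)

lemma words_Suc: "words m (Suc p) = (\<lambda>(j, w). j # w) ` ({..<m} \<times> words m p)"
  by (auto simp: words_def length_Suc_conv image_iff)

lemma multiwords_of_degree_0: "multiwords_of_degree 0 n p = {\<lambda>_. undefined}"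
  by (simp add: multiwords_of_degree_def multiwords_def)

lemma multiwords_of_degree_Suc:
  "multiwords_of_degree (Suc k) n p
    = (\<lambda>(\<alpha>, w). \<alpha>(k := w)) ` (multiwords_of_degree k n p \<times> words (n k) (p k))"
proof (intro equalityI subsetI)
  fix \<alpha> assume \<alpha>: "\<alpha> \<in> multiwords_of_degree (Suc k) n p"
  then have "\<alpha>(k := undefined) \<in> multiwords_of_degree k n p" "\<alpha> k \<in> words (n k) (p k)"
    by (auto simp: multiwords_of_degree_def multiwords_def words_def PiE_iff extensional_def)
  then show "\<alpha> \<in> (\<lambda>(\<alpha>, w). \<alpha>(k := w)) ` (multiwords_of_degree k n p \<times> words (n k) (p k))"
    by (intro image_eqI[of _ _ "(\<alpha>(k := undefined), \<alpha> k)"]) auto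
qed (auto simp: multiwords_of_degree_def multiwords_def words_def PiE_iff extensional_def less_Suc_eq in_lists_conv_set)

lemma inj_on_multiword_append:
  "inj_on (\<lambda>(\<alpha>, w). \<alpha>(k := w)) (multiwords_of_degree k n p \<times> words (n k) (p k))"
proof (rule inj_onI, clarify)
  fix \<alpha> w \<beta> v
  assume \<alpha>: "\<alpha> \<in> multiwords_of_degree k n p" and \<beta>: "\<beta> \<in> multiwords_of_degree k n p"
    and eq: "\<alpha>(k := w) = \<beta>(k := v)"
  have "\<alpha> k = undefined" "\<beta> k = undefined"
    using \<alpha> \<beta> by (auto simp: multiwords_of_degree_def multiwords_def PiE_iff extensional_def)
  then have "\<alpha> i = \<beta> i" for i using fun_cong[OF eq, of i] by (cases "i = k") auto
  then show "\<alpha> = \<beta> \<and> w = v" using fun_cong[OF eq, of k] by auto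
qed

lemma finite_multiwords_of_degree: "finite (multiwords_of_degree k n p)"
proof (induction k)
  case (Suc k)
  have "finite (words m q)" for m q by (induction q) (simp_all add: words_0 words_Suc)
  then show ?case unfolding multiwords_of_degree_Suc using Suc by simp
qed (simp add: multiwords_of_degree_0)

lemma word_op_bounded_ops: "(\<And>j. Xi j \<in> bounded_ops) \<Longrightarrow> word_op Xi w \<in> bounded_ops"
  by (induction w) (simp_all add: word_op_def bounded_ops_id bounded_ops_compose)

lemma blinfun_compose_assoc: "(R o\<^sub>L S) o\<^sub>L T = R o\<^sub>L (S o\<^sub>L T)"
  by (rule blinfun_eqI) simp

lemma blinfun_compose_id_right: "S o\<^sub>L id_blinfun = S"
  by (rule blinfun_eqI) simp

lemma foldr_compose_blinfun:
  "foldr (\<lambda>i T. F i o\<^sub>L T) xs id_blinfun o\<^sub>L S = foldr (\<lambda>i T. F i o\<^sub>L T) xs S"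
proof (induction xs)
  case Nil
  show ?case by simp (rule blinfun_eqI, simp)
qed (simp add: blinfun_compose_assoc)

lemma multiword_op_Suc: "multiword_op (Suc k) X \<alpha> = multiword_op k X \<alpha> o\<^sub>L word_op (X k) (\<alpha> k)"
  by (simp add: multiword_op_def foldr_compose_blinfun blinfun_compose_id_right)

lemma multiword_op_bounded_ops: "(\<And>i j. X i j \<in> bounded_ops) \<Longrightarrow> multiword_op k X \<alpha> \<in> bounded_ops"
  by (induction k)
     (simp_all add: multiword_op_Suc bounded_ops_compose word_op_bounded_ops, simp add: multiword_op_def bounded_ops_id)

lemma multiword_op_cong:
  "(\<And>i. i < k \<Longrightarrow> \<alpha> i = \<beta> i) \<Longrightarrow> multiword_op k X \<alpha> = multiword_op k X \<beta>"
  by (induction k) (simp_all add: multiword_op_Suc, simp add: multiword_op_def)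

lemma row_bounded_words:
  assumes "row_bounded {..<m} Xi b" "0 \<le> b"
  shows "row_bounded (words m p) (word_op Xi) (b ^ p)"
proof (induction p)
  case 0
  have "row_bounded ((\<lambda>_. []) ` {0::nat}) (word_op Xi) 1"
    by (rule row_bounded_reindex[OF _ row_bounded_singleton_id]) (simp_all add: word_op_def)
  then show ?case by (simp add: words_0)
next
  case (Suc p)
  have "row_bounded ({..<m} \<times> words m p) (\<lambda>(j, w). Xi j o\<^sub>L word_op Xi w) (b * b ^ p)"
    by (rule row_bounded_product[OF assms(1) Suc assms(2)])
  then show ?case unfolding words_Suc power_Suc
    by (rule row_bounded_reindex[rotated]) (auto simp: inj_on_def word_op_def)
qed

text \<open>
  The row of all \<open>X\<^sub>(\<^sub>\<alpha>\<^sub>)\<close> of multidegree \<open>p\<close> is the product of the rows of words of length \<open>p i\<close> in \<open>X i\<close>.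
\<close>

lemma row_bounded_multiwords:
  assumes "\<And>i. i < k \<Longrightarrow> row_bounded {..<n i} (X i) (b i)" "\<And>i. i < k \<Longrightarrow> 0 \<le> b i"
  shows "row_bounded (multiwords_of_degree k n p) (multiword_op k X) (\<Prod>i<k. b i ^ p i)"
  using assms
proof (induction k)
  case 0
  have "row_bounded ((\<lambda>_ _. undefined) ` {0::nat}) (multiword_op 0 X) 1"
    by (rule row_bounded_reindex[OF _ row_bounded_singleton_id]) (simp_all add: multiword_op_def)
  then show ?case by (simp add: multiwords_of_degree_0)
next
  case (Suc k)
  have "row_bounded (multiwords_of_degree k n p \<times> words (n k) (p k))
      (\<lambda>(\<alpha>, w). multiword_op k X \<alpha> o\<^sub>L word_op (X k) w) ((\<Prod>i<k. b i ^ p i) * b k ^ p k)"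
    using Suc.prems by (intro row_bounded_product Suc.IH row_bounded_words prod_nonneg) auto
  then show ?case
    unfolding multiwords_of_degree_Suc prod.lessThan_Suc
  proof (intro row_bounded_reindex[OF inj_on_multiword_append], assumption, clarify)
    fix \<alpha> w
    show "multiword_op (Suc k) X (\<alpha>(k := w)) = multiword_op k X \<alpha> o\<^sub>L word_op (X k) w"
      unfolding multiword_op_Suc by (simp, subst multiword_op_cong[of k _ \<alpha>]) auto
  qed
qed


section \<open>Summability over multidegrees\<close>

lemma summable_on_multidegrees_geometric:
  fixes q :: "nat \<Rightarrow> real"
  assumes "\<And>i. i < k \<Longrightarrow> 0 \<le> q i" "\<And>i. i < k \<Longrightarrow> q i < 1"
  shows "(\<lambda>p. \<Prod>i<k. q i ^ p i) summable_on multidegrees k"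
proof -
  have "Infinite_Set_Sum.abs_summable_on (\<lambda>l. q i ^ l) UNIV" if "i < k" for i
    unfolding abs_summable_equivalent[symmetric]
    by (rule norm_summable_imp_summable_on) (use assms that in \<open>simp add: summable_geometric\<close>)
  then have "Infinite_Set_Sum.abs_summable_on (\<lambda>p. \<Prod>i\<in>{..<k}. q i ^ p i) (PiE {..<k} (\<lambda>_. UNIV))"
    by (intro abs_summable_on_prod_PiE) auto
  then have "(\<lambda>p. norm (\<Prod>i<k. q i ^ p i)) summable_on multidegrees k"
    unfolding multidegrees_def abs_summable_equivalent[symmetric] by simp
  then show ?thesis by (rule abs_summable_summable)
qed

text \<open>
  Outside a finite set, every term is the difference of two partial sums close to the limit.
\<close>

lemma summable_on_imp_terms_bounded:
  fixes f :: "'a \<Rightarrow> 'b::real_normed_vector"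
  assumes "f summable_on S"
  shows "\<exists>C. \<forall>x\<in>S. norm (f x) \<le> C"
proof -
  obtain s where "(f has_sum s) S" using assms by (auto simp: summable_on_def)
  then have "\<forall>\<^sub>F F in finite_subsets_at_top S. dist (sum f F) s < 1"
    unfolding has_sum_def by (rule tendstoD) simp
  then obtain F where F: "finite F" "F \<subseteq> S"
    and "\<forall>G. finite G \<and> F \<subseteq> G \<and> G \<subseteq> S \<longrightarrow> dist (sum f G) s < 1"
    unfolding eventually_finite_subsets_at_top by (elim exE conjE)
  then have close: "dist (sum f G) s < 1" if "finite G" "F \<subseteq> G" "G \<subseteq> S" for G
    using that by simp
  have "norm (f x) \<le> 2 + (\<Sum>y\<in>F. norm (f y))" if x: "x \<in> S" for x
  proof (cases "x \<in> F")
    case True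
    then show ?thesis using member_le_sum[of x F "\<lambda>y. norm (f y)"] F by simp
  next
    case False
    have "f x = sum f (insert x F) - sum f F" using F False by simp
    then have "norm (f x) = dist (sum f (insert x F)) (sum f F)" by (simp add: dist_norm)
    also have "\<dots> \<le> dist (sum f (insert x F)) s + dist (sum f F) s" by (rule dist_triangle2)
    also have "\<dots> \<le> 2" using close[of F] close[of "insert x F"] F x by (simp add: subset_insertI)
    also have "\<dots> \<le> 2 + (\<Sum>y\<in>F. norm (f y))" by (simp add: sum_nonneg)
    finally show ?thesis .
  qed
  then show ?thesis by blast
qed


section \<open>Convergence inside the polyball\<close>

lemma coefficient_norms_bound:
  assumes "bounded (coefficient_norms k n r A)"
  shows "\<exists>M\<ge>0. \<forall>p\<in>multidegrees k.
    (\<Prod>i<k. r i ^ (2 * p i)) * norm (\<Sum>\<alpha>\<in>multiwords_of_degree k n p. cadjoint (A \<alpha>) o\<^sub>L A \<alpha>) \<le> M"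
proof -
  obtain M where M: "\<And>x. x \<in> coefficient_norms k n r A \<Longrightarrow> \<bar>x\<bar> \<le> M"
    using assms unfolding bounded_iff by auto
  have "(\<Prod>i<k. r i ^ (2 * p i)) * norm (\<Sum>\<alpha>\<in>multiwords_of_degree k n p. cadjoint (A \<alpha>) o\<^sub>L A \<alpha>) \<le> \<bar>M\<bar>"
    if "p \<in> multidegrees k" for p
  proof -
    have "norm ((\<Prod>i<k. r i ^ (2 * p i)) *\<^sub>R
        (\<Sum>\<alpha>\<in>multiwords_of_degree k n p. cadjoint (A \<alpha>) o\<^sub>L A \<alpha>)) \<le> M"
      using M[of "norm ((\<Prod>i<k. r i ^ (2 * p i)) *\<^sub>R
        (\<Sum>\<alpha>\<in>multiwords_of_degree k n p. cadjoint (A \<alpha>) o\<^sub>L A \<alpha>))"] that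
      by (auto simp: coefficient_norms_def)
    moreover have "0 \<le> (\<Prod>i<k. r i ^ (2 * p i))" by (simp add: prod_nonneg)
    ultimately show ?thesis by simp
  qed
  then show ?thesis by (intro exI[of _ "\<bar>M\<bar>"]) simp
qed

text \<open>
  The number \<open>q i\<close> compares the size of \<open>X i\<close> with the radius \<open>r i\<close>.  Splitting off the powers of \<open>r\<close> from the
  row bound turns the norm of the column into a coefficient norm.
\<close>

lemma homogeneous_part_bound:
  fixes tens :: "'k::chilbert_space \<Rightarrow> 'h::chilbert_space \<Rightarrow> 'e::chilbert_space"
    and A :: "(nat \<Rightarrow> nat list) \<Rightarrow> 'k \<Rightarrow>\<^sub>L 'k"
  assumes tensor: "hilbert_tensor tens"
    and A: "\<And>\<alpha>. \<alpha> \<in> multiwords k n \<Longrightarrow> A \<alpha> \<in> bounded_ops"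
    and r: "\<And>i. i < k \<Longrightarrow> 0 < r i" and "0 \<le> M"
    and M: "(\<Prod>i<k. r i ^ (2 * p i)) * norm (\<Sum>\<alpha>\<in>multiwords_of_degree k n p. cadjoint (A \<alpha>) o\<^sub>L A \<alpha>) \<le> M"
    and X: "\<And>i j. X i j \<in> bounded_ops"
    and row: "\<And>i. i < k \<Longrightarrow> row_bounded {..<n i} (X i) ((r i * q i)\<^sup>2)"
    and q: "\<And>i. i < k \<Longrightarrow> 0 \<le> q i"
  shows "norm (homogeneous_part tens k n A X p) \<le> sqrt M * (\<Prod>i<k. q i ^ p i)"
proof -
  define a where "a = norm (\<Sum>\<alpha>\<in>multiwords_of_degree k n p. cadjoint (A \<alpha>) o\<^sub>L A \<alpha>)"
  define b where "b = (\<Prod>i<k. ((r i * q i)\<^sup>2) ^ p i)"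
  have A': "A \<alpha> \<in> bounded_ops" if "\<alpha> \<in> multiwords_of_degree k n p" for \<alpha>
    using that A by (simp add: multiwords_of_degree_def)
  have "row_bounded (multiwords_of_degree k n p) (multiword_op k X) b"
    unfolding b_def by (rule row_bounded_multiwords[OF row]) simp_all
  then have "norm (homogeneous_part tens k n A X p) \<le> sqrt (a * b)"
    unfolding homogeneous_part_def
    by (intro norm_sum_op_tensor_le[OF tensor] A' multiword_op_bounded_ops X row_boundedD)
       (auto simp: a_def b_def columns_bounded A' finite_multiwords_of_degree prod_nonneg)
  also have "a * b = ((\<Prod>i<k. r i ^ (2 * p i)) * a) * (\<Prod>i<k. q i ^ p i)\<^sup>2"
    unfolding b_def by (simp add: power_mult_distrib prod.distrib prod_power_distrib power_mult[symmetric] mult_ac)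
  also have "sqrt \<dots> \<le> sqrt (M * (\<Prod>i<k. q i ^ p i)\<^sup>2)"
    using M unfolding a_def by (intro real_sqrt_le_mono mult_right_mono) auto
  also have "\<dots> = sqrt M * (\<Prod>i<k. q i ^ p i)"
    using prod_nonneg[of "{..<k}" "\<lambda>i. q i ^ p i"] q by (simp add: real_sqrt_mult)
  finally show ?thesis .
qed


section \<open>Weighted composition operators\<close>

definition weighted_composition ::
    "(nat \<Rightarrow> real) \<Rightarrow> (nat \<Rightarrow> nat) \<Rightarrow> complex ell2 \<Rightarrow>\<^sub>L complex ell2" where
  "weighted_composition w \<sigma> = Blinfun (\<lambda>x. Abs_ell2 (\<lambda>m. w m *\<^sub>R ell2_nth x (\<sigma> m)))"

text \<open>
  Injectivity of \<open>\<sigma>\<close> makes the sum of the \<open>\<parallel>x (\<sigma> m)\<parallel>\<^sup>2\<close> a part of the sum of the \<open>\<parallel>x m\<parallel>\<^sup>2\<close>.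
\<close>

lemma
  assumes w: "\<And>m. \<bar>w m\<bar> \<le> B" and \<sigma>: "inj \<sigma>"
  shows ell2_nth_weighted_composition:
      "ell2_nth (blinfun_apply (weighted_composition w \<sigma>) x) m = w m *\<^sub>R ell2_nth x (\<sigma> m)"
    and weighted_composition_bounded_ops: "weighted_composition w \<sigma> \<in> bounded_ops"
proof -
  define f where "f x = (Abs_ell2 (\<lambda>m. w m *\<^sub>R ell2_nth x (\<sigma> m)) :: complex ell2)" for x :: "complex ell2"
  have partial: "(\<Sum>m<N. (norm (w m *\<^sub>R ell2_nth x (\<sigma> m)))\<^sup>2) \<le> B\<^sup>2 * (norm x)\<^sup>2"
    for N and x :: "complex ell2"
  proof -
    have "(\<Sum>m<N. (norm (w m *\<^sub>R ell2_nth x (\<sigma> m)))\<^sup>2) \<le> (\<Sum>m<N. B\<^sup>2 * (norm (ell2_nth x (\<sigma> m)))\<^sup>2)"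
    proof (rule sum_mono)
      fix m
      have "(norm (w m *\<^sub>R ell2_nth x (\<sigma> m)))\<^sup>2 = \<bar>w m\<bar>\<^sup>2 * (norm (ell2_nth x (\<sigma> m)))\<^sup>2"
        by (simp add: power_mult_distrib)
      also have "\<dots> \<le> B\<^sup>2 * (norm (ell2_nth x (\<sigma> m)))\<^sup>2"
        by (intro mult_right_mono power_mono w) auto
      finally show "(norm (w m *\<^sub>R ell2_nth x (\<sigma> m)))\<^sup>2 \<le> B\<^sup>2 * (norm (ell2_nth x (\<sigma> m)))\<^sup>2" .
    qed
    also have "\<dots> = B\<^sup>2 * (\<Sum>m\<in>\<sigma> ` {..<N}. (norm (ell2_nth x m))\<^sup>2)"
      by (simp add: sum.reindex[OF inj_on_subset[OF \<sigma> subset_UNIV]] sum_distrib_left)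
    also have "\<dots> \<le> B\<^sup>2 * (norm x)\<^sup>2"
      unfolding norm_ell2_sq by (intro mult_left_mono sum_le_suminf summable_ell2_nth) auto
    finally show ?thesis .
  qed
  have summable: "summable (\<lambda>m. (norm (w m *\<^sub>R ell2_nth x (\<sigma> m)))\<^sup>2)" for x :: "complex ell2"
    by (rule summableI_nonneg_bounded[OF _ partial]) simp
  then have nth: "ell2_nth (f x) m = w m *\<^sub>R ell2_nth x (\<sigma> m)" for x m
    by (simp add: f_def Abs_ell2_inverse)
  have bl: "bounded_linear f"
  proof (rule bounded_linear_intro)
    show "f (x + y) = f x + f y" for x y
      by (simp add: ell2_nth_inject[symmetric] fun_eq_iff nth plus_ell2.rep_eq scaleR_add_right)
    show "f (a *\<^sub>R x) = a *\<^sub>R f x" for a x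
      by (simp add: ell2_nth_inject[symmetric] fun_eq_iff nth scaleR_ell2.rep_eq)
    show "norm (f x) \<le> norm x * \<bar>B\<bar>" for x
    proof -
      have "(norm (f x))\<^sup>2 \<le> B\<^sup>2 * (norm x)\<^sup>2"
        unfolding norm_ell2_sq[of "f x"] nth by (rule suminf_le_const[OF summable partial])
      then have "(norm (f x))\<^sup>2 \<le> (norm x * \<bar>B\<bar>)\<^sup>2" by (simp add: power_mult_distrib mult.commute)
      then show ?thesis by (rule power2_le_imp_le) simp
    qed
  qed
  have app: "blinfun_apply (weighted_composition w \<sigma>) = f"
    unfolding weighted_composition_def f_def[symmetric] by (rule bounded_linear_Blinfun_apply[OF bl])
  show "ell2_nth (blinfun_apply (weighted_composition w \<sigma>) x) m = w m *\<^sub>R ell2_nth x (\<sigma> m)"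
    by (simp add: app nth)
  have "f (c *\<^sub>C x) = c *\<^sub>C f x" for c x
    by (simp add: ell2_nth_inject[symmetric] fun_eq_iff nth scaleC_ell2.rep_eq scaleC_complex_def)
  then show "weighted_composition w \<sigma> \<in> bounded_ops" by (simp add: bounded_ops_def app)
qed

definition unit_vector :: "nat \<Rightarrow> complex ell2" where
  "unit_vector m = Abs_ell2 (\<lambda>i. if i = m then 1 else 0)"

lemma ell2_nth_unit_vector: "ell2_nth (unit_vector m) i = (if i = m then 1 else 0)"
proof -
  have "summable (\<lambda>i. (norm (if i = m then 1 else 0 :: complex))\<^sup>2)"
    by (rule summable_finite[of "{m}"]) auto
  then show ?thesis by (simp add: unit_vector_def Abs_ell2_inverse)
qed

lemma cinner_unit_vector: "cinner x (unit_vector m) = ell2_nth x m"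
proof -
  have "(\<lambda>i. cinner (ell2_nth x i) (ell2_nth (unit_vector m) i)) = (\<lambda>i. if i = m then ell2_nth x i else 0)"
    by (auto simp: ell2_nth_unit_vector cinner_complex_def)
  then show ?thesis
    using sums_unique[OF sums_single[of m "ell2_nth x"]] by (simp add: cinner_ell2.rep_eq)
qed


section \<open>Creation operators\<close>

lemma countably_infinite_multiwords:
  assumes "1 \<le> k" and "\<And>i. i < k \<Longrightarrow> 1 \<le> n i"
  shows "countable (multiwords k n)" and "infinite (multiwords k n)"
proof -
  show "countable (multiwords k n)"
    unfolding multiwords_def by (intro countable_PiE countable_lists) auto
  define w where "w = (\<lambda>l. \<lambda>i\<in>{..<k}. replicate l (0::nat))"
  have "inj w"
  proof (rule injI)
    fix l l' assume "w l = w l'"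
    then have "w l 0 = w l' 0" by simp
    then show "l = l'" using assms(1) by (simp add: w_def)
  qed
  moreover have "range w \<subseteq> multiwords k n"
    using assms(2) by (fastforce simp: w_def multiwords_def in_lists_conv_set)
  ultimately show "infinite (multiwords k n)" using infinite_super range_inj_infinite by blast
qed

text \<open>
  The tensor product of the full Fock spaces has a canonical orthonormal basis indexed by multiwords.
  The numbering \<open>code\<close> identifies this space with the square summable scalar sequences.
\<close>

context
  fixes k :: nat and n :: "nat \<Rightarrow> nat" and code :: "(nat \<Rightarrow> nat list) \<Rightarrow> nat"
  assumes code: "bij_betw code (multiwords k n) UNIV"
begin

definition decode :: "nat \<Rightarrow> nat \<Rightarrow> nat list" where
  "decode = inv_into (multiwords k n) code"

definition coord :: "complex ell2 \<Rightarrow> (nat \<Rightarrow> nat list) \<Rightarrow> complex" where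
  "coord x \<alpha> = ell2_nth x (code \<alpha>)"

definition basis :: "(nat \<Rightarrow> nat list) \<Rightarrow> complex ell2" where
  "basis \<alpha> = unit_vector (code \<alpha>)"

lemma decode_in: "decode m \<in> multiwords k n"
  using code unfolding decode_def bij_betw_def by (intro inv_into_into) auto

lemma code_decode [simp]: "code (decode m) = m"
  unfolding decode_def by (rule bij_betw_inv_into_right[OF code]) simp

lemma decode_code: "\<alpha> \<in> multiwords k n \<Longrightarrow> decode (code \<alpha>) = \<alpha>"
  unfolding decode_def by (rule bij_betw_inv_into_left[OF code])

lemma code_eq_iff: "\<alpha> \<in> multiwords k n \<Longrightarrow> \<beta> \<in> multiwords k n \<Longrightarrow> code \<alpha> = code \<beta> \<longleftrightarrow> \<alpha> = \<beta>"
  by (rule inj_on_eq_iff[OF bij_betw_imp_inj_on[OF code]])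

lemma ell2_nth_coord: "ell2_nth x m = coord x (decode m)"
  by (simp add: coord_def)

lemma coord_eqI: "x = y" if "\<And>\<alpha>. \<alpha> \<in> multiwords k n \<Longrightarrow> coord x \<alpha> = coord y \<alpha>"
  by (simp add: ell2_nth_inject[symmetric] fun_eq_iff ell2_nth_coord that decode_in)

lemma coord_zero [simp]: "coord 0 \<alpha> = 0"
  by (simp add: coord_def zero_ell2.rep_eq)

lemma coord_add: "coord (x + y) \<alpha> = coord x \<alpha> + coord y \<alpha>"
  by (simp add: coord_def plus_ell2.rep_eq)

lemma coord_diff: "coord (x - y) \<alpha> = coord x \<alpha> - coord y \<alpha>"
  by (simp add: coord_def minus_ell2.rep_eq)

lemma coord_scaleR: "coord (a *\<^sub>R x) \<alpha> = a *\<^sub>R coord x \<alpha>"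
  by (simp add: coord_def scaleR_ell2.rep_eq)

lemma coord_sum: "coord (\<Sum>i\<in>I. x i) \<alpha> = (\<Sum>i\<in>I. coord (x i) \<alpha>)"
  by (induction I rule: infinite_finite_induct) (simp_all add: coord_add)

lemma cinner_basis: "cinner x (basis \<alpha>) = coord x \<alpha>"
  by (simp add: basis_def coord_def cinner_unit_vector)

lemma coord_basis:
  "\<alpha> \<in> multiwords k n \<Longrightarrow> \<beta> \<in> multiwords k n \<Longrightarrow> coord (basis \<beta>) \<alpha> = (if \<alpha> = \<beta> then 1 else 0)"
  by (simp add: coord_def basis_def ell2_nth_unit_vector code_eq_iff)

lemma norm_basis [simp]: "norm (basis \<alpha>) = 1"
proof -
  have "complex_of_real ((norm (basis \<alpha>))\<^sup>2) = 1"
    by (simp only: cinner_self[symmetric] cinner_basis) (simp add: coord_def basis_def ell2_nth_unit_vector)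
  then have "(norm (basis \<alpha>))\<^sup>2 = 1" by (simp only: of_real_eq_1_iff)
  then show ?thesis using norm_ge_zero[of "basis \<alpha>"] by (auto simp: power2_eq_1_iff)
qed

lemma multiwords_update:
  "\<alpha> \<in> multiwords k n \<Longrightarrow> i < k \<Longrightarrow> w \<in> lists {..<n i} \<Longrightarrow> \<alpha>(i := w) \<in> multiwords k n"
  by (auto simp: multiwords_def PiE_iff extensional_def)

lemma multiwords_nth: "\<alpha> \<in> multiwords k n \<Longrightarrow> i < k \<Longrightarrow> \<alpha> i \<in> lists {..<n i}"
  by (auto simp: multiwords_def PiE_iff)

lemma multiwords_cons:
  "\<alpha> \<in> multiwords k n \<Longrightarrow> i < k \<Longrightarrow> j < n i \<Longrightarrow> \<alpha>(i := j # \<alpha> i) \<in> multiwords k n"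
  using multiwords_nth[of \<alpha> i] by (intro multiwords_update) auto

lemma multiwords_tl: "\<alpha> \<in> multiwords k n \<Longrightarrow> i < k \<Longrightarrow> \<alpha>(i := tl (\<alpha> i)) \<in> multiwords k n"
  by (rule multiwords_update) (use multiwords_nth[of \<alpha> i] in \<open>cases "\<alpha> i"; simp\<close>)+

text \<open>
  Composition with an injective map of the index set is a bounded operator on sequences; the creation
  operators are introduced as the adjoints of such compositions.
\<close>

definition annihilation :: "nat \<Rightarrow> nat \<Rightarrow> complex ell2 \<Rightarrow>\<^sub>L complex ell2" where
  "annihilation i j = weighted_composition (\<lambda>_. 1) (\<lambda>m. code ((decode m)(i := j # decode m i)))"

text \<open>
  The left creation operators of the full Fock spaces, acting on the tensor product of these spaces
  (whose canonical basis is indexed by multiwords): \<open>creation i j\<close> prepends the letter \<open>j\<close> to the \<open>i\<close>-th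
  word.
\<close>

definition creation :: "nat \<Rightarrow> nat \<Rightarrow> complex ell2 \<Rightarrow>\<^sub>L complex ell2" where
  "creation i j = (if i < k \<and> j < n i then cadjoint (annihilation i j) else 0)"

lemma
  assumes ij: "i < k" "j < n i"
  shows annihilation_bounded_ops: "annihilation i j \<in> bounded_ops"
    and coord_annihilation:
      "\<alpha> \<in> multiwords k n \<Longrightarrow> coord (blinfun_apply (annihilation i j) x) \<alpha> = coord x (\<alpha>(i := j # \<alpha> i))"
proof -
  have inj: "inj (\<lambda>m. code ((decode m)(i := j # decode m i)))"
  proof (rule injI)
    fix m m' assume "code ((decode m)(i := j # decode m i)) = code ((decode m')(i := j # decode m' i))"
    then have eq: "(decode m)(i := j # decode m i) = (decode m')(i := j # decode m' i)"
      by (simp add: code_eq_iff multiwords_cons decode_in ij)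
    have "decode m l = decode m' l" for l
      using fun_cong[OF eq, of l] by (cases "l = i") auto
    then have "decode m = decode m'" by blast
    then show "m = m'" by (metis code_decode)
  qed
  have one: "\<bar>1\<bar> \<le> (1::real)" by simp
  show "annihilation i j \<in> bounded_ops"
    unfolding annihilation_def by (rule weighted_composition_bounded_ops[OF one inj])
  show "coord (blinfun_apply (annihilation i j) x) \<alpha> = coord x (\<alpha>(i := j # \<alpha> i))"
    if "\<alpha> \<in> multiwords k n"
    unfolding annihilation_def coord_def
    by (simp add: ell2_nth_weighted_composition[OF one inj] decode_code that)
qed

lemma creation_bounded_ops: "creation i j \<in> bounded_ops"
  by (simp add: creation_def annihilation_bounded_ops cadjoint_bounded_ops bounded_ops_zero)

lemma cadjoint_creation: "i < k \<Longrightarrow> j < n i \<Longrightarrow> cadjoint (creation i j) = annihilation i j"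
  by (simp add: creation_def annihilation_bounded_ops cadjoint_cadjoint)

lemma annihilation_basis:
  assumes ij: "i < k" "j < n i" and \<alpha>: "\<alpha> \<in> multiwords k n"
  shows "blinfun_apply (annihilation i j) (basis \<alpha>)
    = (if \<alpha> i \<noteq> [] \<and> hd (\<alpha> i) = j then basis (\<alpha>(i := tl (\<alpha> i))) else 0)"
proof (rule coord_eqI)
  fix \<beta> assume \<beta>: "\<beta> \<in> multiwords k n"
  have "\<beta>(i := j # \<beta> i) = \<alpha> \<longleftrightarrow> (\<alpha> i \<noteq> [] \<and> hd (\<alpha> i) = j) \<and> \<beta> = \<alpha>(i := tl (\<alpha> i))"
    by (cases "\<alpha> i") (auto simp: fun_eq_iff split: if_splits)
  then show "coord (blinfun_apply (annihilation i j) (basis \<alpha>)) \<beta>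
      = coord (if \<alpha> i \<noteq> [] \<and> hd (\<alpha> i) = j then basis (\<alpha>(i := tl (\<alpha> i))) else 0) \<beta>"
    using ij \<alpha> \<beta> by (simp add: coord_annihilation coord_basis multiwords_cons multiwords_tl)
qed

text \<open>
  The coordinate at \<open>\<alpha>\<close> is the inner product with a basis vector, so passing to the adjoint reduces
  the claim to the action of \<open>annihilation i j\<close> on that vector.
\<close>

lemma coord_creation:
  assumes ij: "i < k" "j < n i" and \<alpha>: "\<alpha> \<in> multiwords k n"
  shows "coord (blinfun_apply (creation i j) x) \<alpha>
    = (if \<alpha> i \<noteq> [] \<and> hd (\<alpha> i) = j then coord x (\<alpha>(i := tl (\<alpha> i))) else 0)"
proof -
  have "coord (blinfun_apply (creation i j) x) \<alpha> = cinner x (blinfun_apply (annihilation i j) (basis \<alpha>))"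
    unfolding cinner_basis[symmetric] cinner_cadjoint[OF creation_bounded_ops]
    by (simp add: cadjoint_creation ij)
  then show ?thesis by (simp add: annihilation_basis[OF assms] cinner_basis)
qed

lemma creation_basis:
  assumes ij: "i < k" "j < n i" and \<alpha>: "\<alpha> \<in> multiwords k n"
  shows "blinfun_apply (creation i j) (basis \<alpha>) = basis (\<alpha>(i := j # \<alpha> i))"
proof (rule coord_eqI)
  fix \<beta> assume \<beta>: "\<beta> \<in> multiwords k n"
  have "\<beta> = \<alpha>(i := j # \<alpha> i) \<longleftrightarrow> (\<beta> i \<noteq> [] \<and> hd (\<beta> i) = j) \<and> \<beta>(i := tl (\<beta> i)) = \<alpha>"
    by (cases "\<beta> i") (auto simp: fun_eq_iff split: if_splits)
  then show "coord (blinfun_apply (creation i j) (basis \<alpha>)) \<beta> = coord (basis (\<alpha>(i := j # \<alpha> i))) \<beta>"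
    using ij \<alpha> \<beta> by (simp add: coord_creation coord_basis multiwords_cons multiwords_tl)
qed

lemma creation_commute:
  assumes "s < k" "t < k" "s \<noteq> t" "p < n s" "q < n t"
  shows "creation s p o\<^sub>L creation t q = creation t q o\<^sub>L creation s p"
proof (intro blinfun_eqI coord_eqI)
  fix x \<alpha> assume \<alpha>: "\<alpha> \<in> multiwords k n"
  show "coord (blinfun_apply (creation s p o\<^sub>L creation t q) x) \<alpha>
      = coord (blinfun_apply (creation t q o\<^sub>L creation s p) x) \<alpha>"
    using assms \<alpha> by (simp add: coord_creation multiwords_tl fun_upd_twist)
qed


section \<open>Creation operators lie in the closed polyball\<close>

definition diagonal :: "((nat \<Rightarrow> nat list) \<Rightarrow> real) \<Rightarrow> (complex ell2 \<Rightarrow>\<^sub>L complex ell2) \<Rightarrow> bool" where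
  "diagonal f Y \<longleftrightarrow> (\<forall>x. \<forall>\<alpha>\<in>multiwords k n. coord (blinfun_apply Y x) \<alpha> = f \<alpha> *\<^sub>R coord x \<alpha>)"

lemma norm_diagonal_le:
  assumes Y: "diagonal f Y" and f: "\<And>\<alpha>. \<alpha> \<in> multiwords k n \<Longrightarrow> \<bar>f \<alpha>\<bar> \<le> B" and "0 \<le> B"
  shows "norm Y \<le> B"
proof (rule norm_blinfun_bound)
  fix x
  have nth: "ell2_nth (blinfun_apply Y x) m = f (decode m) *\<^sub>R ell2_nth x m" for m
    using Y by (simp add: diagonal_def ell2_nth_coord decode_in)
  have le: "(norm (ell2_nth (blinfun_apply Y x) m))\<^sup>2 \<le> B\<^sup>2 * (norm (ell2_nth x m))\<^sup>2" for m
    unfolding nth norm_scaleR power_mult_distrib by (intro mult_right_mono power_mono f decode_in) auto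
  have "(norm (blinfun_apply Y x))\<^sup>2 \<le> B\<^sup>2 * (norm x)\<^sup>2"
    unfolding norm_ell2_sq suminf_mult[OF summable_ell2_nth, symmetric]
    by (intro suminf_le le summable_ell2_nth summable_mult)
  then have "(norm (blinfun_apply Y x))\<^sup>2 \<le> (B * norm x)\<^sup>2" by (simp add: power_mult_distrib)
  then show "norm (blinfun_apply Y x) \<le> B * norm x"
    by (rule power2_le_imp_le) (simp add: \<open>0 \<le> B\<close>)
qed fact

lemma positive_invertible_diagonal:
  assumes Y: "diagonal f Y" and f: "\<And>\<alpha>. \<alpha> \<in> multiwords k n \<Longrightarrow> d \<le> f \<alpha>" and d: "0 < d"
  shows "positive_invertible Y"
  unfolding positive_invertible_def
proof
  have f_pos: "0 < f (decode m)" for m using f[OF decode_in, of m] d by linarith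
  show "\<forall>x. cinner (blinfun_apply Y x) x \<in> \<real>\<^sub>\<ge>\<^sub>0"
  proof
    fix x
    have "cinner (blinfun_apply Y x) x
        = (\<Sum>m. complex_of_real (f (decode m) * (norm (ell2_nth x m))\<^sup>2))"
      using Y by (simp add: cinner_ell2.rep_eq diagonal_def ell2_nth_coord decode_in cinner_complex_def
          complex_norm_square scaleR_conv_of_real mult.assoc del: of_real_power)
    moreover have "summable (\<lambda>m. complex_of_real (f (decode m) * (norm (ell2_nth x m))\<^sup>2))"
      using summable_cinner[OF summable_ell2_nth[of "blinfun_apply Y x"] summable_ell2_nth[of x]] Y
      by (simp add: diagonal_def ell2_nth_coord decode_in cinner_complex_def
          complex_norm_square scaleR_conv_of_real mult.assoc del: of_real_power)
    ultimately show "cinner (blinfun_apply Y x) x \<in> \<real>\<^sub>\<ge>\<^sub>0"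
      using f_pos by (simp add: suminf_of_real[symmetric] summable_of_real_iff suminf_nonneg less_imp_le
          del: of_real_mult)
  qed
  define S where "S = weighted_composition (\<lambda>m. 1 / f (decode m)) id"
  have "\<bar>1 / f (decode m)\<bar> \<le> 1 / d" for m
    using f[OF decode_in, of m] d f_pos[of m] by (simp add: frac_le)
  then have S: "coord (blinfun_apply S x) \<alpha> = (1 / f \<alpha>) *\<^sub>R coord x \<alpha>" if "\<alpha> \<in> multiwords k n" for x \<alpha>
    unfolding S_def coord_def using that by (subst ell2_nth_weighted_composition) (auto simp: decode_code)
  have f0: "f \<alpha> \<noteq> 0" if "\<alpha> \<in> multiwords k n" for \<alpha> using f[OF that] d by linarith
  have "S o\<^sub>L Y = id_blinfun" "Y o\<^sub>L S = id_blinfun"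
    using Y f0 by (auto intro!: blinfun_eqI coord_eqI simp: S diagonal_def)
  then show "\<exists>S. S o\<^sub>L Y = id_blinfun \<and> Y o\<^sub>L S = id_blinfun" by blast
qed

text \<open>
  Conjugation with \<open>creation i j\<close> moves a diagonal entry from \<open>\<beta>\<close> to \<open>\<beta>(i := j # \<beta> i)\<close>; every \<open>\<alpha>\<close> with
  \<open>\<alpha> i \<noteq> []\<close> arises in this way for exactly one letter \<open>j\<close>.
\<close>

lemma diagonal_cp_map:
  assumes i: "i < k" and Y: "diagonal f Y"
  shows "diagonal (\<lambda>\<alpha>. if \<alpha> i = [] then 0 else t\<^sup>2 * f (\<alpha>(i := tl (\<alpha> i))))
    (cp_map (n i) (\<lambda>j. t *\<^sub>R creation i j) Y)"
  unfolding diagonal_def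
proof (intro allI ballI)
  fix x \<alpha> assume \<alpha>: "\<alpha> \<in> multiwords k n"
  have "coord (blinfun_apply (cp_map (n i) (\<lambda>j. t *\<^sub>R creation i j) Y) x) \<alpha>
      = (\<Sum>j<n i. t *\<^sub>R (if \<alpha> i \<noteq> [] \<and> hd (\<alpha> i) = j
          then t *\<^sub>R f (\<alpha>(i := tl (\<alpha> i))) *\<^sub>R coord x (\<alpha>(i := j # tl (\<alpha> i))) else 0))"
    unfolding cp_map_def blinfun.sum_left coord_sum
  proof (rule sum.cong)
    fix j assume "j \<in> {..<n i}"
    then have j: "j < n i" by simp
    show "coord (blinfun_apply (t *\<^sub>R creation i j o\<^sub>L Y o\<^sub>L cadjoint (t *\<^sub>R creation i j)) x) \<alpha>
        = t *\<^sub>R (if \<alpha> i \<noteq> [] \<and> hd (\<alpha> i) = j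
          then t *\<^sub>R f (\<alpha>(i := tl (\<alpha> i))) *\<^sub>R coord x (\<alpha>(i := j # tl (\<alpha> i))) else 0)"
      using i j \<alpha> Y
      by (simp add: cadjoint_scaleR creation_bounded_ops cadjoint_creation blinfun.scaleR_left
          blinfun.scaleR_right coord_scaleR coord_creation multiwords_tl diagonal_def coord_annihilation)
  qed simp
  also have "\<dots> = (if \<alpha> i = [] then 0 else t\<^sup>2 * f (\<alpha>(i := tl (\<alpha> i)))) *\<^sub>R coord x \<alpha>"
  proof (cases "\<alpha> i")
    case (Cons a w)
    then have "a < n i" using multiwords_nth[OF \<alpha> i] by simp
    moreover have "\<alpha>(i := a # w) = \<alpha>" using Cons by auto
    ultimately show ?thesis
      using Cons by (simp add: if_distrib[of "scaleR t"] sum.delta power2_eq_square mult.assoc cong: if_cong)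
  qed simp
  finally show "coord (blinfun_apply (cp_map (n i) (\<lambda>j. t *\<^sub>R creation i j) Y) x) \<alpha>
      = (if \<alpha> i = [] then 0 else t\<^sup>2 * f (\<alpha>(i := tl (\<alpha> i)))) *\<^sub>R coord x \<alpha>" .
qed

lemma diagonal_id: "diagonal (\<lambda>_. 1) id_blinfun"
  by (simp add: diagonal_def)

lemma diagonal_diff: "diagonal f Y \<Longrightarrow> diagonal g Z \<Longrightarrow> diagonal (\<lambda>\<alpha>. f \<alpha> - g \<alpha>) (Y - Z)"
  by (simp add: diagonal_def blinfun.diff_left coord_diff scaleR_diff_left)

lemma foldr_comp_apply: "foldr (\<lambda>i F. G i \<circ> F) xs id Y = foldr G xs Y"
  by (induction xs) simp_all

text \<open>
  The diagonal entry obtained from the indices in \<open>xs\<close> does not depend on the word at a further index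
  \<open>a\<close>, so the map for \<open>a\<close> multiplies it by \<open>1\<close> or by \<open>1 - t\<^sup>2\<close>.
\<close>

lemma diagonal_defect:
  assumes "distinct xs" "set xs \<subseteq> {..<k}"
  shows "diagonal (\<lambda>\<alpha>. \<Prod>i\<in>set xs. if \<alpha> i = [] then 1 else 1 - t\<^sup>2)
    (foldr (\<lambda>i Y. Y - cp_map (n i) (\<lambda>j. t *\<^sub>R creation i j) Y) xs id_blinfun)"
  using assms
proof (induction xs)
  case Nil
  show ?case by (simp add: diagonal_id)
next
  case (Cons a xs)
  define f where "f \<alpha> = (\<Prod>i\<in>set xs. if \<alpha> i = [] then 1 else 1 - t\<^sup>2)" for \<alpha> :: "nat \<Rightarrow> nat list"
  define Y where "Y = foldr (\<lambda>i Y. Y - cp_map (n i) (\<lambda>j. t *\<^sub>R creation i j) Y) xs id_blinfun"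
  have a: "a < k" "a \<notin> set xs" using Cons.prems by auto
  have "f (\<alpha>(a := w)) = f \<alpha>" for \<alpha> w
    unfolding f_def using a by (intro prod.cong) auto
  then have eq: "(\<lambda>\<alpha>. f \<alpha> - (if \<alpha> a = [] then 0 else t\<^sup>2 * f (\<alpha>(a := tl (\<alpha> a)))))
      = (\<lambda>\<alpha>. \<Prod>i\<in>set (a # xs). if \<alpha> i = [] then 1 else 1 - t\<^sup>2)"
    using a by (auto simp: fun_eq_iff f_def algebra_simps)
  have "diagonal f Y" unfolding f_def Y_def using Cons.prems by (intro Cons.IH) auto
  from diagonal_diff[OF this diagonal_cp_map[OF a(1) this, of t]]
  show ?case unfolding eq by (simp add: Y_def)
qed

lemma scaled_creation_in_polyball:
  assumes t: "0 \<le> t" "t < 1"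
  shows "(\<lambda>i j. t *\<^sub>R creation i j) \<in> polyball k n"
  unfolding polyball_def
proof (intro CollectI conjI allI impI)
  show "(\<lambda>i j. t *\<^sub>R creation i j) \<in> commuting_tuples k n"
  proof -
    have "(t *\<^sub>R creation s p) o\<^sub>L (t *\<^sub>R creation u q) = (t *\<^sub>R creation u q) o\<^sub>L (t *\<^sub>R creation s p)"
      if "s < k" "u < k" "s \<noteq> u" "p < n s" "q < n u" for s u p q
    proof -
      have "blinfun_apply (creation s p) (blinfun_apply (creation u q) x)
          = blinfun_apply (creation u q) (blinfun_apply (creation s p) x)" for x
        using arg_cong[OF creation_commute[OF that], of "\<lambda>T. blinfun_apply T x"] by simp
      then show ?thesis
        by (intro blinfun_eqI) (simp add: blinfun.scaleR_left blinfun.scaleR_right)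
    qed
    moreover have "if i < k \<and> j < n i then t *\<^sub>R creation i j \<in> bounded_ops else t *\<^sub>R creation i j = 0" for i j
      by (simp add: bounded_ops_scaleR creation_bounded_ops) (simp add: creation_def)
    ultimately show ?thesis unfolding commuting_tuples_def by blast
  qed
next
  have t2: "t\<^sup>2 < 1" using t by (simp add: power_less_one_iff)
  fix i assume i: "i < k"
  have "cp_map (n i) (\<lambda>j. t *\<^sub>R creation i j) id_blinfun
      = (\<Sum>j<n i. (t *\<^sub>R creation i j) o\<^sub>L cadjoint (t *\<^sub>R creation i j))"
    by (simp add: cp_map_def blinfun_compose_id_right)
  moreover have "norm (cp_map (n i) (\<lambda>j. t *\<^sub>R creation i j) id_blinfun) \<le> t\<^sup>2"
    by (rule norm_diagonal_le[OF diagonal_cp_map[OF i diagonal_id]]) auto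
  ultimately show "norm (\<Sum>j<n i. (t *\<^sub>R creation i j) o\<^sub>L cadjoint (t *\<^sub>R creation i j)) < 1"
    using t2 by simp
next
  have t2: "0 < 1 - t\<^sup>2" "1 - t\<^sup>2 \<le> 1" using t by (simp_all add: power_less_one_iff)
  show "positive_invertible (defect_map k n (\<lambda>i j. t *\<^sub>R creation i j) id_blinfun)"
  proof (rule positive_invertible_diagonal)
    show "diagonal (\<lambda>\<alpha>. \<Prod>i\<in>set [0..<k]. if \<alpha> i = [] then 1 else 1 - t\<^sup>2)
        (defect_map k n (\<lambda>i j. t *\<^sub>R creation i j) id_blinfun)"
      unfolding defect_map_def foldr_comp_apply by (rule diagonal_defect) auto
    show "(1 - t\<^sup>2) ^ k \<le> (\<Prod>i\<in>set [0..<k]. if \<alpha> i = [] then 1 else 1 - t\<^sup>2)" for \<alpha> :: "nat \<Rightarrow> nat list"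
    proof -
      have "(1 - t\<^sup>2) ^ k = (\<Prod>i\<in>set [0..<k]. 1 - t\<^sup>2)" by simp
      also have "\<dots> \<le> (\<Prod>i\<in>set [0..<k]. if \<alpha> i = [] then 1 else 1 - t\<^sup>2)"
        using t2 by (intro prod_mono) auto
      finally show ?thesis .
    qed
    show "0 < (1 - t\<^sup>2) ^ k" using t2 by simp
  qed
qed

text \<open>
  As \<open>t\<close> increases to \<open>1\<close>, the multiples by \<open>t\<close>, which lie in the polyball, converge to the tuple.
\<close>

lemma creation_in_closure_polyball: "creation \<in> closure (polyball k n)"
proof -
  have "continuous_on UNIV (\<lambda>(t::real) i j. t *\<^sub>R creation i j)"
    by (intro continuous_intros)
  then have "(\<lambda>(t::real) i j. t *\<^sub>R creation i j) ` closure {0..<1}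
      \<subseteq> closure ((\<lambda>t i j. t *\<^sub>R creation i j) ` {0..<1})"
    by (intro continuous_image_closure_subset) auto
  also have "\<dots> \<subseteq> closure (polyball k n)"
    by (intro closure_mono) (auto intro: scaled_creation_in_polyball)
  finally have "(\<lambda>i j. (1::real) *\<^sub>R creation i j) \<in> closure (polyball k n)" by fastforce
  then show ?thesis by simp
qed


section \<open>Lower bounds at the creation operators\<close>

lemma word_op_creation_basis:
  assumes i: "i < k" and w: "w \<in> lists {..<n i}" and \<alpha>: "\<alpha> \<in> multiwords k n"
  shows "blinfun_apply (word_op (\<lambda>j. a *\<^sub>R creation i j) w) (basis \<alpha>)
    = a ^ length w *\<^sub>R basis (\<alpha>(i := w @ \<alpha> i))"
  using w
proof (induction rule: lists.induct)
  case (Cons j w)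
  have j: "j < n i" and w': "w \<in> lists {..<n i}" using Cons.hyps by simp_all
  have "w @ \<alpha> i \<in> lists {..<n i}" using w' multiwords_nth[OF \<alpha> i] by simp
  note prepend = creation_basis[OF i j multiwords_update[OF \<alpha> i this]]
  have "blinfun_apply (word_op (\<lambda>j. a *\<^sub>R creation i j) (j # w)) (basis \<alpha>)
      = a *\<^sub>R blinfun_apply (creation i j)
          (blinfun_apply (word_op (\<lambda>j. a *\<^sub>R creation i j) w) (basis \<alpha>))"
    by (simp add: word_op_def blinfun.scaleR_left)
  also have "\<dots> = a ^ length (j # w) *\<^sub>R basis (\<alpha>(i := (j # w) @ \<alpha> i))"
    unfolding Cons.IH blinfun.scaleR_right prepend by simp
  finally show ?case .
qed (simp add: word_op_def)

lemma foldr_word_op_creation_vacuum: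
  assumes "distinct xs" "set xs \<subseteq> {..<k}" and \<alpha>: "\<alpha> \<in> multiwords k n"
  shows "blinfun_apply (foldr (\<lambda>i T. word_op (\<lambda>j. r i *\<^sub>R creation i j) (\<alpha> i) o\<^sub>L T) xs id_blinfun)
      (basis (\<lambda>i. if i < k then [] else undefined))
    = (\<Prod>i\<in>set xs. r i ^ length (\<alpha> i)) *\<^sub>R basis (\<lambda>i. if i < k then if i \<in> set xs then \<alpha> i else [] else undefined)"
  using assms(1,2)
proof (induction xs)
  case (Cons a xs)
  define \<beta> where "\<beta> = (\<lambda>i. if i < k then if i \<in> set xs then \<alpha> i else [] else undefined)"
  have a: "a < k" "a \<notin> set xs" using Cons.prems by auto
  have \<beta>: "\<beta> \<in> multiwords k n" using \<alpha> by (auto simp: \<beta>_def multiwords_def PiE_iff extensional_def)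
  have "\<beta>(a := \<alpha> a @ \<beta> a) = (\<lambda>i. if i < k then if i \<in> set (a # xs) then \<alpha> i else [] else undefined)"
    using a by (auto simp: \<beta>_def fun_eq_iff)
  then show ?case
    using Cons a word_op_creation_basis[OF a(1) multiwords_nth[OF \<alpha> a(1)] \<beta>, of "r a"]
    by (simp add: blinfun.scaleR_right mult.commute flip: \<beta>_def)
qed (simp cong: if_cong)

lemma multiword_op_creation_vacuum:
  assumes \<alpha>: "\<alpha> \<in> multiwords_of_degree k n p"
  shows "blinfun_apply (multiword_op k (polyscale r creation) \<alpha>) (basis (\<lambda>i. if i < k then [] else undefined))
    = (\<Prod>i<k. r i ^ p i) *\<^sub>R basis \<alpha>"
proof -
  have W: "\<alpha> \<in> multiwords k n" and len: "\<And>i. i < k \<Longrightarrow> length (\<alpha> i) = p i"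
    using \<alpha> by (auto simp: multiwords_of_degree_def)
  have "(\<lambda>i. if i < k then if i \<in> set [0..<k] then \<alpha> i else [] else undefined) = \<alpha>"
    using W by (auto simp: multiwords_def PiE_iff extensional_def fun_eq_iff)
  moreover have "(\<Prod>i\<in>set [0..<k]. r i ^ length (\<alpha> i)) = (\<Prod>i<k. r i ^ p i)"
    by (rule prod.cong) (auto simp: len)
  ultimately show ?thesis
    using foldr_word_op_creation_vacuum[of "[0..<k]" \<alpha> r] W
    by (simp add: multiword_op_def polyscale_def atLeast0LessThan)
qed

text \<open>
  Applied to \<open>x\<close> tensored with the vacuum, the summands of the homogeneous part are orthogonal: the
  \<open>\<alpha>\<close>-th one is a multiple of \<open>A \<alpha> x\<close> tensored with the basis vector of \<open>\<alpha>\<close>.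
\<close>

lemma homogeneous_part_creation:
  fixes tens :: "'k::chilbert_space \<Rightarrow> complex ell2 \<Rightarrow> 'f::chilbert_space"
  assumes tensor: "hilbert_tensor tens" and A: "\<And>\<alpha>. \<alpha> \<in> multiwords k n \<Longrightarrow> A \<alpha> \<in> bounded_ops"
    and r: "\<And>i. i < k \<Longrightarrow> 0 < r i"
  shows "norm ((\<Prod>i<k. r i ^ (2 * p i)) *\<^sub>R
      (\<Sum>\<alpha>\<in>multiwords_of_degree k n p. cadjoint (A \<alpha>) o\<^sub>L A \<alpha>))
    \<le> (norm (homogeneous_part tens k n A (polyscale r creation) p))\<^sup>2"
proof -
  define P where "P = multiwords_of_degree k n p"
  define T where "T = homogeneous_part tens k n A (polyscale r creation) p"
  define c where "c = (\<Prod>i<k. r i ^ p i)"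
  define e where "e = basis (\<lambda>i. if i < k then [] else undefined)"
  have P: "finite P" and PW: "\<And>\<alpha>. \<alpha> \<in> P \<Longrightarrow> \<alpha> \<in> multiwords k n"
    by (simp_all add: P_def finite_multiwords_of_degree) (simp add: multiwords_of_degree_def)
  have c: "0 < c" unfolding c_def using r by (intro prod_pos) auto
  have X: "polyscale r creation i j \<in> bounded_ops" for i j
    by (simp add: polyscale_def bounded_ops_scaleR creation_bounded_ops)
  have orth: "cinner (c *\<^sub>R basis \<alpha>) (c *\<^sub>R basis \<beta>) = 0" if "\<alpha> \<in> P" "\<beta> \<in> P" "\<alpha> \<noteq> \<beta>" for \<alpha> \<beta>
    unfolding scaleC_of_real[symmetric] cinner_scaleC_left cinner_scaleC_right unfolding cinner_basis
    using that by (simp add: coord_basis PW)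
  have "(\<Sum>\<alpha>\<in>P. (norm (blinfun_apply (A \<alpha>) x))\<^sup>2) \<le> ((norm T)\<^sup>2 / c\<^sup>2) * (norm x)\<^sup>2" for x
  proof -
    have "blinfun_apply T (tens x e) = (\<Sum>\<alpha>\<in>P. tens (blinfun_apply (A \<alpha>) x) (c *\<^sub>R basis \<alpha>))"
      unfolding T_def homogeneous_part_def P_def[symmetric] blinfun.sum_left
    proof (rule sum.cong)
      fix \<alpha> assume \<alpha>: "\<alpha> \<in> P"
      show "blinfun_apply (op_tensor tens (A \<alpha>) (multiword_op k (polyscale r creation) \<alpha>)) (tens x e)
          = tens (blinfun_apply (A \<alpha>) x) (c *\<^sub>R basis \<alpha>)"
        using \<alpha> multiword_op_creation_vacuum[of \<alpha> p r]
        by (simp add: op_tensor_apply[OF tensor A[OF PW[OF \<alpha>]] multiword_op_bounded_ops[OF X]]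
            P_def c_def e_def)
    qed simp
    moreover have "(norm (\<Sum>\<alpha>\<in>P. tens (blinfun_apply (A \<alpha>) x) (c *\<^sub>R basis \<alpha>)))\<^sup>2
        = (\<Sum>\<alpha>\<in>P. (norm (blinfun_apply (A \<alpha>) x))\<^sup>2 * (norm (c *\<^sub>R basis \<alpha>))\<^sup>2)"
      using tensor P orth by (rule norm_sum_tens_orthogonal_right)
    ultimately have "(\<Sum>\<alpha>\<in>P. (norm (blinfun_apply (A \<alpha>) x))\<^sup>2) * c\<^sup>2 = (norm (blinfun_apply T (tens x e)))\<^sup>2"
      by (simp add: sum_distrib_right)
    also have "\<dots> \<le> (norm T)\<^sup>2 * (norm (tens x e))\<^sup>2" by (rule norm_blinfun_sq)
    also have "norm (tens x e) = norm x" by (simp add: norm_tens[OF tensor] e_def)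
    finally show ?thesis using c by (simp add: field_simps)
  qed
  then have "norm (\<Sum>\<alpha>\<in>P. cadjoint (A \<alpha>) o\<^sub>L A \<alpha>) \<le> (norm T)\<^sup>2 / c\<^sup>2"
    by (intro norm_sum_le_if_columns_bounded A PW) auto
  moreover have "(\<Prod>i<k. r i ^ (2 * p i)) = c\<^sup>2"
    by (simp add: c_def prod_power_distrib power_mult[symmetric] mult.commute)
  ultimately show ?thesis using c by (simp add: P_def T_def field_simps)
qed

end

text \<open>
  At \<open>r\<close> times the creation operators, the square of the norm of each homogeneous part is at least the
  coefficient norm of the same multidegree.
\<close>

lemma exists_divergence_point:
  fixes tens :: "'k::chilbert_space \<Rightarrow> complex ell2 \<Rightarrow> 'f::chilbert_space"
  assumes "1 \<le> k" and "\<And>i. i < k \<Longrightarrow> 1 \<le> n i" and r: "\<And>i. i < k \<Longrightarrow> 0 < r i"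
    and A: "\<And>\<alpha>. \<alpha> \<in> multiwords k n \<Longrightarrow> A \<alpha> \<in> bounded_ops"
    and tensor: "hilbert_tensor tens"
    and unbounded: "\<not> bounded (coefficient_norms k n r A)"
  shows "\<exists>X \<in> polyscale r ` closure (polyball k n).
    \<forall>C. \<exists>p\<in>multidegrees k. C < norm (homogeneous_part tens k n A X p)"
proof -
  define code where "code = to_nat_on (multiwords k n)"
  have code: "bij_betw code (multiwords k n) UNIV"
    unfolding code_def
    by (rule to_nat_on_infinite) (rule countably_infinite_multiwords[OF assms(1,2)]; assumption)+
  define X where "X = polyscale r (creation k n code)"
  show ?thesis
  proof (rule bexI[of _ X], rule allI)
    show "X \<in> polyscale r ` closure (polyball k n)"
      unfolding X_def by (intro imageI creation_in_closure_polyball[OF code])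
    fix C
    show "\<exists>p\<in>multidegrees k. C < norm (homogeneous_part tens k n A X p)"
    proof (rule ccontr)
      assume "\<not> ?thesis"
      then have C: "norm (homogeneous_part tens k n A X p) \<le> C" if "p \<in> multidegrees k" for p
        using that by (simp add: not_less)
      have "\<bar>y\<bar> \<le> C\<^sup>2" if y_in: "y \<in> coefficient_norms k n r A" for y
      proof -
        obtain p where p: "p \<in> multidegrees k" and y: "y = norm ((\<Prod>i<k. r i ^ (2 * p i)) *\<^sub>R
            (\<Sum>\<alpha>\<in>multiwords_of_degree k n p. cadjoint (A \<alpha>) o\<^sub>L A \<alpha>))"
          using y_in unfolding coefficient_norms_def by blast
        have "y \<le> (norm (homogeneous_part tens k n A X p))\<^sup>2"
          unfolding y X_def by (rule homogeneous_part_creation[OF code tensor A r])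
        also have "\<dots> \<le> C\<^sup>2" by (intro power_mono C p) simp
        finally show ?thesis by (simp add: y)
      qed
      then have "bounded (coefficient_norms k n r A)" unfolding bounded_iff by auto
      then show False using unbounded by simp
    qed
  qed
qed

section \<open>The dichotomy\<close>

theorem theorem1p4:
  fixes k :: nat and n :: "nat \<Rightarrow> nat" and r :: "nat \<Rightarrow> real"
    and A :: "(nat \<Rightarrow> nat list) \<Rightarrow> ('k::chilbert_space \<Rightarrow>\<^sub>L 'k)"
    and tensH :: "'k \<Rightarrow> 'h::chilbert_space \<Rightarrow> 'e::chilbert_space"
    and tensL :: "'k \<Rightarrow> complex ell2 \<Rightarrow> 'f::chilbert_space"
  assumes "1 \<le> k" and "\<And>i. i < k \<Longrightarrow> 1 \<le> n i" and "\<And>i. i < k \<Longrightarrow> 0 < r i"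
    and "\<And>\<alpha>. \<alpha> \<in> multiwords k n \<Longrightarrow> A \<alpha> \<in> bounded_ops"
    and "hilbert_tensor tensH" and "hilbert_tensor tensL"
  shows
    "(bounded (coefficient_norms k n r A) \<longrightarrow>
       (\<forall>X \<in> polyscale r ` polyball k n.
          (\<lambda>p. norm (homogeneous_part tensH k n A X p)) summable_on multidegrees k) \<and>
       (\<forall>s. (\<forall>i<k. 0 \<le> s i \<and> s i < r i) \<longrightarrow>
          uniform_limit (polyscale s ` closure (polyball k n))
            (\<lambda>F X. \<Sum>p\<in>F. norm (homogeneous_part tensH k n A X p))
            (\<lambda>X. \<Sum>\<^sub>\<infinity>p\<in>multidegrees k. norm (homogeneous_part tensH k n A X p))
            (finite_subsets_at_top (multidegrees k)))) \<and>
     (\<not> bounded (coefficient_norms k n r A) \<longrightarrow>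
       (\<exists>X \<in> polyscale r ` closure (polyball k n).
          \<not> (\<lambda>p. norm (homogeneous_part tensL k n A X p)) summable_on multidegrees k \<and>
          \<not> (\<lambda>p. homogeneous_part tensL k n A X p) summable_on multidegrees k))"
proof (intro conjI impI ballI allI)
  note r = assms(3) and A = assms(4)
  assume bounded: "bounded (coefficient_norms k n r A)"
  obtain M where "0 \<le> M" and M: "\<forall>p\<in>multidegrees k.
      (\<Prod>i<k. r i ^ (2 * p i)) * norm (\<Sum>\<alpha>\<in>multiwords_of_degree k n p. cadjoint (A \<alpha>) o\<^sub>L A \<alpha>) \<le> M"
    using coefficient_norms_bound[OF bounded] by (elim exE conjE)
  note bound = homogeneous_part_bound[OF assms(5) A r \<open>0 \<le> M\<close> M[rule_format]]
  {
    fix X :: "nat \<Rightarrow> nat \<Rightarrow> 'h \<Rightarrow>\<^sub>L 'h" assume "X \<in> polyscale r ` polyball k n"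
    then obtain Y where Y: "Y \<in> polyball k n" and X: "X = polyscale r Y" by blast
    have "\<exists>c. 0 \<le> c \<and> c < 1 \<and> row_bounded {..<n i} (Y i) c" if "i < k" for i
      using polyball_row_bounded[OF Y that] by metis
    then obtain c where c: "\<And>i. i < k \<Longrightarrow> 0 \<le> c i" "\<And>i. i < k \<Longrightarrow> c i < 1"
      "\<And>i. i < k \<Longrightarrow> row_bounded {..<n i} (Y i) (c i)" by metis
    define q where "q i = sqrt (c i)" for i
    have q: "0 \<le> q i" "q i < 1" if "i < k" for i using c that by (simp_all add: q_def)
    have "row_bounded {..<n i} (X i) ((r i * q i)\<^sup>2)" if "i < k" for i
      using row_bounded_scaleR[OF c(3)[OF that], of "r i"] c(1)[OF that]
      by (simp add: X polyscale_def q_def power_mult_distrib)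
    moreover have "X i j \<in> bounded_ops" for i j
      by (simp add: X polyscale_def bounded_ops_scaleR polyball_bounded_ops[OF Y])
    ultimately have le: "norm (homogeneous_part tensH k n A X p) \<le> sqrt M * (\<Prod>i<k. q i ^ p i)"
      if "p \<in> multidegrees k" for p
      using that q(1) by (intro bound) auto
    have "(\<lambda>p. sqrt M * (\<Prod>i<k. q i ^ p i)) summable_on multidegrees k"
      by (intro summable_on_cmult_right summable_on_multidegrees_geometric q)
    then show "(\<lambda>p. norm (homogeneous_part tensH k n A X p)) summable_on multidegrees k"
      by (rule summable_on_comparison_test) (simp_all add: le)
  }
  {
    fix s assume s: "\<forall>i<k. 0 \<le> s i \<and> s i < r i"
    define q where "q i = s i / r i" for i
    have q: "0 \<le> q i" "q i < 1" "r i * q i = s i" if "i < k" for i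
      using s r[OF that] that by (auto simp: q_def)
    show "uniform_limit (polyscale s ` closure (polyball k n))
        (\<lambda>F X. \<Sum>p\<in>F. norm (homogeneous_part tensH k n A X p))
        (\<lambda>X. \<Sum>\<^sub>\<infinity>p\<in>multidegrees k. norm (homogeneous_part tensH k n A X p))
        (finite_subsets_at_top (multidegrees k))"
    proof (rule Weierstrass_m_test_general)
      show "(\<lambda>p. sqrt M * (\<Prod>i<k. q i ^ p i)) summable_on multidegrees k"
        by (intro summable_on_cmult_right summable_on_multidegrees_geometric q)
      fix p and X :: "nat \<Rightarrow> nat \<Rightarrow> 'h \<Rightarrow>\<^sub>L 'h"
      assume p: "p \<in> multidegrees k" and "X \<in> polyscale s ` closure (polyball k n)"
      then obtain Y where Y: "Y \<in> closure (polyball k n)" and X: "X = polyscale s Y" by blast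
      have "row_bounded {..<n i} (X i) ((r i * q i)\<^sup>2)" if "i < k" for i
        using row_bounded_scaleR[OF closure_polyball(2)[OF Y that], of "s i"]
        by (simp add: X polyscale_def q(3)[OF that])
      moreover have "X i j \<in> bounded_ops" for i j
        by (simp add: X polyscale_def bounded_ops_scaleR closure_polyball(1)[OF Y])
      ultimately show "norm (norm (homogeneous_part tensH k n A X p)) \<le> sqrt M * (\<Prod>i<k. q i ^ p i)"
        unfolding real_norm_def abs_norm_cancel using p q(1) by (intro bound) auto
    qed
  }
next
  assume unbounded: "\<not> bounded (coefficient_norms k n r A)"
  have "\<exists>X \<in> polyscale r ` closure (polyball k n).
      \<forall>C. \<exists>p\<in>multidegrees k. C < norm (homogeneous_part tensL k n A X p)"
    using assms(1-4,6) unbounded by (rule exists_divergence_point)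
  then obtain X where X: "X \<in> polyscale r ` closure (polyball k n)"
    and large: "\<forall>C. \<exists>p\<in>multidegrees k. C < norm (homogeneous_part tensL k n A X p)"
    by (elim bexE)
  have no_bound: "\<not> (\<exists>C. \<forall>p\<in>multidegrees k. norm (homogeneous_part tensL k n A X p) \<le> C)"
    using large by (meson not_le)
  have "\<not> (\<lambda>p. norm (homogeneous_part tensL k n A X p)) summable_on multidegrees k"
    using summable_on_imp_terms_bounded[of "\<lambda>p. norm (homogeneous_part tensL k n A X p)" "multidegrees k"]
      no_bound
    by auto
  moreover have "\<not> (\<lambda>p. homogeneous_part tensL k n A X p) summable_on multidegrees k"
    using summable_on_imp_terms_bounded[of "\<lambda>p. homogeneous_part tensL k n A X p" "multidegrees k"]
      no_bound
    by auto
  ultimately show "\<exists>X \<in> polyscale r ` closure (polyball k n).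
      \<not> (\<lambda>p. norm (homogeneous_part tensL k n A X p)) summable_on multidegrees k \<and>
      \<not> (\<lambda>p. homogeneous_part tensL k n A X p) summable_on multidegrees k"
    using X by blast
qed

end
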